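(* Let $n\geqslant 2$ and let $A$ be a convex body in $\mathbb{R}^n$. Then for any pair of convex bodies $K_1,K_2$ in $\mathbb{R}^n$, $$|A|\,V(K_1,K_2,A[n-2])\leqslant 2\,V(K_1,A[n-1])\,V(K_2,A[n-1]).$$ *)

theory Defs
  imports "HOL-Analysis.Analysis" "HOL-Library.Set_Algebras"
begin

definition convex_body :: "(real^'n::finite) set \<Rightarrow> bool" where
  "convex_body K \<longleftrightarrow> compact K \<and> convex K \<and> K \<noteq> {}"

text \<open>Mixed volume V(K_0,...,K_{n-1}) of n = CARD('n) sets, given as a list,
  defined by the polarization formula
  V(K_1..K_n) = 1/n! * sum over nonempty S of (-1)^(n-|S|) * vol(sum_{i in S} K_i),
  where the inner sum is the Minkowski sum.\<close>
definition mixed_volume :: "(real^'n::finite) set list \<Rightarrow> real" where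
  "mixed_volume Ks =
     (1 / fact CARD('n)) *
     (\<Sum>S\<in>{S. S \<subseteq> {..<CARD('n)} \<and> S \<noteq> {}}.
        (-1) ^ (CARD('n) - card S) * measure lebesgue (\<Sum>i\<in>S. Ks ! i))"

end

theory Submission
  imports Defs
begin

text \<open>
  For polytopes \<open>K_j = conv P_j\<close> with interior points, the gradient of
  \<open>\<Sum>j. a_j ln (\<Sum>v\<in>P_j. exp (x \<bullet> v))\<close> maps the whole space injectively onto \<open>\<Sum>j. a_j K_j\<close> up to its
  boundary. Its Jacobian is a Gram matrix, so the change of variables formula and the Cauchy-Binet
  expansion show that the volume of \<open>\<Sum>j. a_j K_j\<close> is a polynomial in \<open>a\<close> with nonnegative coefficients;
  polarization identifies these with the mixed volumes.
  By Brunn-Minkowski, \<open>|A + t (x K1 + y K2)|^(1/n)\<close> is concave in \<open>t\<close>. Comparing second-order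
  coefficients at \<open>t = 0\<close> and dropping the nonnegative terms \<open>V(K_i, K_i, A[n-2])\<close> gives
  \<open>2 x y |A| V(K1, K2, A[n-2]) \<le> (x V(K1, A[n-1]) + y V(K2, A[n-1]))^2\<close>, and
  \<open>x = V(K2, A[n-1])\<close>, \<open>y = V(K1, A[n-1])\<close> yields the claim. General bodies are limits of polytopes.
\<close>

section \<open>The Brunn-Minkowski inequality\<close>

text \<open>\<open>mixed_volume\<close> is an alternating sum of volumes, so neither its
  multilinearity nor the sign of V(K_i, K_i, A[n-2]) can be read off. The gradient maps supply both
  at once: for all weights \<open>a\<close> they live on the same domain, and at each point their
  Jacobian determinant is already a polynomial in \<open>a\<close> with nonnegative coefficients, so
  integration over the whole space keeps both properties. Interior points make these maps injective
  and |A| positive; polytopes that approximate from outside provide them even for flat bodies.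

  The second-order comparison amounts to |A| V(L, L, A[n-2]) \<le> V(L, A[n-1])^2 for L = x K1 + y
  K2. The factor 2 on its left-hand side is the mixed term of V(L, L, A[n-2]), which occurs twice.
  With p = V(K1, A[n-1]), q = V(K2, A[n-1]) the choice x = q, y = p balances the two summands of the
  square, and 2 c p q \<le> (2 p q)^2 leaves the constant 2. If p or q vanishes this choice says
  nothing, hence a small shift of both and a limit.\<close>

definition box_family :: "'a::euclidean_space set set \<Rightarrow> bool" where
  "box_family F \<longleftrightarrow> finite F \<and> F \<noteq> {} \<and> disjoint F \<and> (\<forall>B\<in>F. B \<noteq> {} \<and> (\<exists>a b. B = box a b))"

lemma box_family_Union:
  assumes "box_family F"
  shows "open (\<Union>F)" "bounded (\<Union>F)" "\<Union>F \<in> lmeasurable" "0 < measure lebesgue (\<Union>F)"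
proof -
  show o: "open (\<Union>F)" using assms unfolding box_family_def by (metis open_Union open_box)
  show b: "bounded (\<Union>F)" using assms unfolding box_family_def by (metis bounded_Union bounded_box)
  show m: "\<Union>F \<in> lmeasurable" using o b by (rule lmeasurable_open[rotated])
  have "\<Union>F \<noteq> {}" using assms unfolding box_family_def by auto
  with o have "\<not> negligible (\<Union>F)" by (rule open_not_negligible)
  with m show "0 < measure lebesgue (\<Union>F)"
    by (simp add: negligible_iff_measure zero_less_measure_iff)
qed

text \<open>\<open>H\<close> is any set that cuts boxes to boxes, in use an open half-space. Boxes
  that miss \<open>H\<close> are dropped, so the count falls strictly as soon as one box misses it;
  this drives the induction on the number of boxes.\<close>

lemma box_family_Int:
  assumes F: "box_family F" and H: "\<And>a b. \<exists>a' b'. box a b \<inter> H = box a' b'"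
    and ne: "\<Union>F \<inter> H \<noteq> {}"
  defines "F' \<equiv> (\<lambda>B. B \<inter> H) ` {B\<in>F. B \<inter> H \<noteq> {}}"
  shows "box_family F'" "\<Union>F' = \<Union>F \<inter> H" "card F' \<le> card F"
    "\<And>B. B \<in> F \<Longrightarrow> B \<inter> H = {} \<Longrightarrow> card F' < card F"
proof -
  have fin: "finite F" using F by (simp add: box_family_def)
  show "\<Union>F' = \<Union>F \<inter> H" unfolding F'_def by auto
  show "box_family F'"
    unfolding box_family_def
  proof (intro conjI ballI)
    show "finite F'" unfolding F'_def using fin by auto
    show "F' \<noteq> {}" using ne unfolding F'_def by auto
    show "disjoint F'" using F unfolding F'_def box_family_def pairwise_def disjnt_def by blast
    fix C assume "C \<in> F'"
    then show "C \<noteq> {}" "\<exists>a b. C = box a b" using F H unfolding F'_def box_family_def by fastforce+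
  qed
  have "card F' \<le> card {B\<in>F. B \<inter> H \<noteq> {}}" unfolding F'_def using fin by (simp add: card_image_le)
  moreover have "card {B\<in>F. B \<inter> H \<noteq> {}} \<le> card F" using fin by (intro card_mono) auto
  moreover have "card {B\<in>F. B \<inter> H \<noteq> {}} < card F" if "B \<in> F" "B \<inter> H = {}" for B
    using fin that by (intro psubset_card_mono) auto
  ultimately show "card F' \<le> card F"
    "\<And>B. B \<in> F \<Longrightarrow> B \<inter> H = {} \<Longrightarrow> card F' < card F" by force+
qed

section \<open>Cutting boxes and volumes by coordinate hyperplanes\<close>

lemma box_Int_halfspace_lt:
  assumes "i \<in> Basis"
  shows "\<exists>a' b'. box a b \<inter> {x. x \<bullet> i < c} = box a' (b'::'a::euclidean_space)"
proof (intro exI)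
  show "box a b \<inter> {x. x \<bullet> i < c} = box a (b + (min (b \<bullet> i) c - b \<bullet> i) *\<^sub>R i)"
    using assms by (rule_tac set_eqI) (auto simp: box_def inner_add_left inner_Basis)
qed

lemma box_Int_halfspace_gt:
  assumes "i \<in> Basis"
  shows "\<exists>a' b'. box a b \<inter> {x. c < x \<bullet> i} = box a' (b'::'a::euclidean_space)"
proof (intro exI)
  show "box a b \<inter> {x. c < x \<bullet> i} = box (a + (max (a \<bullet> i) c - a \<bullet> i) *\<^sub>R i) b"
    using assms by (rule_tac set_eqI) (auto simp: box_def inner_add_left inner_Basis)
qed

text \<open>If the sides overlapped in every coordinate, the midpoints of the overlaps would be the
  coordinates of a common point.\<close>

lemma disjoint_boxes_separated:
  fixes a b c d :: "'a::euclidean_space"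
  assumes "box a b \<noteq> {}" "box c d \<noteq> {}" "box a b \<inter> box c d = {}"
  shows "\<exists>i\<in>Basis. b \<bullet> i \<le> c \<bullet> i \<or> d \<bullet> i \<le> a \<bullet> i"
proof (rule ccontr)
  assume "\<not> ?thesis"
  then have *: "c \<bullet> i < b \<bullet> i" "a \<bullet> i < d \<bullet> i" if "i \<in> Basis" for i
    using that by force+
  have **: "a \<bullet> i < b \<bullet> i" "c \<bullet> i < d \<bullet> i" if "i \<in> Basis" for i
    using assms that by (auto simp: box_ne_empty)
  have "(\<Sum>i\<in>Basis. ((max (a \<bullet> i) (c \<bullet> i) + min (b \<bullet> i) (d \<bullet> i)) / 2) *\<^sub>R i) \<in> box a b \<inter> box c d"
    using * ** by (auto simp: mem_box max_def min_def field_simps) (smt (verit))+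
  with assms show False by simp
qed

lemma measure_split_hyperplane:
  assumes "X \<in> lmeasurable" "i \<in> Basis"
  shows "measure lebesgue X = measure lebesgue (X \<inter> {x. x \<bullet> i < c}) + measure lebesgue (X \<inter> {x. c < x \<bullet> (i::'a::euclidean_space)})"
proof -
  have n: "negligible {x. x \<bullet> i = c}" using assms by (intro negligible_standard_hyperplane)
  have m: "X \<inter> {x. x \<bullet> i < c} \<in> lmeasurable" "X \<inter> {x. c < x \<bullet> i} \<in> lmeasurable"
    using assms by (auto intro!: fmeasurable_Int_fmeasurable simp: borel_open open_halfspace_component_lt open_halfspace_component_gt)
  have disj: "X \<inter> {x. x \<bullet> i < c} \<inter> X \<inter> {x. c < x \<bullet> i} = {}" by auto
  have "measure lebesgue ((X \<inter> {x. x \<bullet> i < c}) \<union> (X \<inter> {x. c < x \<bullet> i})) =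
     measure lebesgue (X \<inter> {x. x \<bullet> i < c}) + measure lebesgue (X \<inter> {x. c < x \<bullet> i})"
    using measure_Un3[OF m] by (simp add: Int_assoc[symmetric] disj)
  moreover have "measure lebesgue ((X \<inter> {x. x \<bullet> i < c}) \<union> (X \<inter> {x. c < x \<bullet> i})) = measure lebesgue X"
    by (rule measure_negligible_symdiff)
      (use m assms n in \<open>auto intro: negligible_subset\<close>)
  ultimately show ?thesis by simp
qed

text \<open>The volume below height \<open>d\<close> is Lipschitz in \<open>d\<close>, because the
  slab of \<open>Y\<close> between two heights fits into a box of that thickness; the intermediate
  value theorem then supplies every ratio.\<close>

lemma halfspace_volume_ivt:
  fixes Y :: "'a::euclidean_space set"
  assumes Y: "Y \<in> lmeasurable" "bounded Y" and i: "i \<in> Basis" and l: "0 \<le> l" "l \<le> 1"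
  shows "\<exists>d. measure lebesgue (Y \<inter> {x. x \<bullet> i < d}) = l * measure lebesgue Y"
proof -
  obtain u v where uv: "Y \<subseteq> cbox u v" using Y bounded_subset_cbox_symmetric by blast
  define g where "g d = measure lebesgue (Y \<inter> {x. x \<bullet> i < d})" for d
  define M where "M = (\<Prod>j\<in>Basis - {i}. \<bar>(v - u) \<bullet> j\<bar>)"
  have m: "Y \<inter> {x. x \<bullet> i < d} \<in> lmeasurable" for d
    using Y by (auto intro!: fmeasurable_Int_fmeasurable simp: borel_open open_halfspace_component_lt)
  have inc: "g d' - g d \<le> M * (d' - d)" "g d \<le> g d'" if "d \<le> d'" for d d'
  proof -
    \<comment> \<open>The bounding box of \<open>Y\<close> with its \<open>i\<close>-th side
      replaced by the interval from \<open>d\<close> to \<open>d'\<close>.\<close>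
    let ?C = "cbox (u + (d - u \<bullet> i) *\<^sub>R i) (v + (d' - v \<bullet> i) *\<^sub>R i)"
    have sub: "Y \<inter> {x. x \<bullet> i < d'} \<subseteq> (Y \<inter> {x. x \<bullet> i < d}) \<union> ?C"
    proof
      fix x assume x: "x \<in> Y \<inter> {x. x \<bullet> i < d'}"
      have "x \<in> ?C" if "d \<le> x \<bullet> i"
        unfolding mem_box
      proof
        fix j :: 'a assume j: "j \<in> Basis"
        have "u \<bullet> j \<le> x \<bullet> j" "x \<bullet> j \<le> v \<bullet> j" using x uv j by (auto simp: mem_box)
        then show "(u + (d - u \<bullet> i) *\<^sub>R i) \<bullet> j \<le> x \<bullet> j \<and> x \<bullet> j \<le> (v + (d' - v \<bullet> i) *\<^sub>R i) \<bullet> j"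
          using that x i j by (cases "i = j") (auto simp: inner_add_left inner_Basis)
      qed
      then show "x \<in> (Y \<inter> {x. x \<bullet> i < d}) \<union> ?C" using x by force
    qed
    have "g d' \<le> measure lebesgue ((Y \<inter> {x. x \<bullet> i < d}) \<union> ?C)"
      unfolding g_def using sub m by (intro measure_mono_fmeasurable) (auto simp: fmeasurableD)
    also have "\<dots> \<le> g d + measure lebesgue ?C"
      unfolding g_def using m[of d] by (intro measure_Un_le) (auto simp: fmeasurableD)
    also have "measure lebesgue ?C \<le> (\<Prod>j\<in>Basis. \<bar>(v + (d' - v \<bullet> i) *\<^sub>R i - (u + (d - u \<bullet> i) *\<^sub>R i)) \<bullet> j\<bar>)"
      unfolding measure_completion[OF borel_closed[OF closed_cbox, folded sets_lborel]] measure_lborel_cbox_eq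
      by (auto simp: prod_nonneg inner_diff_left intro!: prod_mono)
    also have "\<dots> = \<bar>d' - d\<bar> * (\<Prod>j\<in>Basis - {i}. \<bar>(v - u) \<bullet> j\<bar>)"
      using i by (subst prod.remove[OF finite_Basis i])
        (auto simp: inner_add_left inner_diff_left inner_Basis intro!: prod.cong split: if_splits)
    finally show "g d' - g d \<le> M * (d' - d)" using that by (simp add: M_def mult.commute)
    show "g d \<le> g d'" unfolding g_def using m that by (intro measure_mono_fmeasurable) (auto simp: fmeasurableD)
  qed
  have "M \<ge> 0" by (simp add: M_def prod_nonneg)
  have "M-lipschitz_on UNIV g"
  proof (rule lipschitz_onI)
    fix x y show "dist (g x) (g y) \<le> M * dist x y"
      using inc[of x y] inc[of y x] by (cases "x \<le> y") (auto simp: dist_real_def)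
  qed fact
  then have cont: "continuous_on UNIV g" by (rule lipschitz_on_continuous_on)
  \<comment> \<open>\<open>Y\<close> lies strictly between the heights \<open>-R\<close> and
    \<open>R\<close>, so \<open>g\<close> runs from 0 to the whole volume.\<close>
  define R where "R = \<bar>u \<bullet> i\<bar> + \<bar>v \<bullet> i\<bar> + 1"
  have Y_i: "u \<bullet> i \<le> x \<bullet> i" "x \<bullet> i \<le> v \<bullet> i" if "x \<in> Y" for x using that uv i by (auto simp: mem_box)
  have e: "Y \<inter> {x. x \<bullet> i < - R} = {}" "Y \<inter> {x. x \<bullet> i < R} = Y"
    using Y_i by (force simp: R_def)+
  have "g (-R) \<le> l * measure lebesgue Y" "l * measure lebesgue Y \<le> g R"
    using l unfolding g_def e by (auto simp: mult_left_le_one_le)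
  moreover have "- R \<le> R" by (simp add: R_def)
  ultimately show ?thesis
    using IVT'[of g "-R" "l * measure lebesgue Y" R] cont continuous_on_subset unfolding g_def by blast
qed

text \<open>Superadditivity of the geometric mean. After division by the right-hand side, the
  arithmetic-geometric mean inequality applies to the ratios \<open>u i / (u i + v i)\<close> and
  \<open>v i / (u i + v i)\<close>, which add up to 1 for each \<open>i\<close>.\<close>

lemma root_prod_add_le:
  fixes u v :: "'a \<Rightarrow> real"
  assumes I: "finite I" "I \<noteq> {}" and pos: "\<And>i. i \<in> I \<Longrightarrow> 0 < u i" "\<And>i. i \<in> I \<Longrightarrow> 0 < v i"
  shows "root (card I) (\<Prod>i\<in>I. u i) + root (card I) (\<Prod>i\<in>I. v i) \<le> root (card I) (\<Prod>i\<in>I. u i + v i)"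
proof -
  have n: "card I > 0" using I by (simp add: card_gt_0_iff)
  have w: "0 < (\<Prod>i\<in>I. u i + v i)" using pos by (auto intro!: prod_pos add_pos_pos)
  have *: "root (card I) (\<Prod>i\<in>I. f i / (u i + v i)) \<le> (\<Sum>i\<in>I. f i / (u i + v i)) / card I"
    if "\<And>i. i \<in> I \<Longrightarrow> 0 < f i" for f
  proof -
    have nn: "0 \<le> f i / (u i + v i)" if "i \<in> I" for i using pos[OF that] \<open>i \<in> I \<Longrightarrow> 0 < f i\<close>[OF that] by simp
    show ?thesis using arith_geom_mean[OF I, of "\<lambda>i. f i / (u i + v i)"] nn n
      by (simp add: root_powr_inverse prod_nonneg sum_divide_distrib)
  qed
  have s: "(\<Sum>i\<in>I. u i / (u i + v i)) + (\<Sum>i\<in>I. v i / (u i + v i)) = card I"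
  proof -
    have "u i / (u i + v i) + v i / (u i + v i) = 1" if "i \<in> I" for i
      using pos[OF that] by (simp add: add_divide_distrib[symmetric])
    then show ?thesis by (simp add: sum.distrib[symmetric])
  qed
  have "root (card I) (\<Prod>i\<in>I. u i / (u i + v i)) + root (card I) (\<Prod>i\<in>I. v i / (u i + v i)) \<le> 1"
    using add_mono[OF *[of u] *[of v]] pos s n by (simp add: add_divide_distrib[symmetric])
  then have "(root (card I) (\<Prod>i\<in>I. u i) + root (card I) (\<Prod>i\<in>I. v i)) / root (card I) (\<Prod>i\<in>I. u i + v i) \<le> 1"
    using n by (simp add: prod_dividef real_root_divide add_divide_distrib)
  then show ?thesis using w n by (simp add: divide_le_eq)
qed

text \<open>A point of the left-hand box sits at a relative position \<open>t i\<close> in its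
  \<open>i\<close>-th side; taking the same relative positions in both summands splits it.\<close>

lemma box_add_superset:
  fixes a b c d :: "'a::euclidean_space"
  assumes "\<And>i. i \<in> Basis \<Longrightarrow> a \<bullet> i < b \<bullet> i" "\<And>i. i \<in> Basis \<Longrightarrow> c \<bullet> i < d \<bullet> i"
  shows "box (a + c) (b + d) \<subseteq> box a b + box c d"
proof
  fix x assume x: "x \<in> box (a + c) (b + d)"
  define t where "t i = (x \<bullet> i - a \<bullet> i - c \<bullet> i) / (b \<bullet> i - a \<bullet> i + (d \<bullet> i - c \<bullet> i))" for i
  define y where "y = (\<Sum>i\<in>Basis. (a \<bullet> i + t i * (b \<bullet> i - a \<bullet> i)) *\<^sub>R i)"
  have t: "0 < t i" "t i < 1" "x \<bullet> i = a \<bullet> i + c \<bullet> i + t i * (b \<bullet> i - a \<bullet> i) + t i * (d \<bullet> i - c \<bullet> i)"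
    if "i \<in> Basis" for i
  proof -
    have p: "0 < b \<bullet> i - a \<bullet> i + (d \<bullet> i - c \<bullet> i)" using assms that by (smt (verit))
    have "a \<bullet> i + c \<bullet> i < x \<bullet> i" "x \<bullet> i < b \<bullet> i + d \<bullet> i"
      using x that by (auto simp: mem_box inner_add_left)
    with p show "0 < t i" "t i < 1" by (auto simp: t_def)
    have "t i * (b \<bullet> i - a \<bullet> i + (d \<bullet> i - c \<bullet> i)) = x \<bullet> i - a \<bullet> i - c \<bullet> i" using p by (simp add: t_def)
    then show "x \<bullet> i = a \<bullet> i + c \<bullet> i + t i * (b \<bullet> i - a \<bullet> i) + t i * (d \<bullet> i - c \<bullet> i)"
      by (simp add: distrib_left)
  qed
  have yi: "y \<bullet> i = a \<bullet> i + t i * (b \<bullet> i - a \<bullet> i)" if "i \<in> Basis" for i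
    using that by (simp add: y_def)
  have lt: "0 < t i * e \<and> t i * e < e" if "i \<in> Basis" "0 < e" for i e
    using t[OF that(1)] that(2) by simp
  have "y \<in> box a b"
    unfolding mem_box
  proof
    fix i :: 'a assume i: "i \<in> Basis"
    show "a \<bullet> i < y \<bullet> i \<and> y \<bullet> i < b \<bullet> i"
      using lt[OF i, of "b \<bullet> i - a \<bullet> i"] assms(1)[OF i] unfolding yi[OF i] by linarith
  qed
  moreover have "x - y \<in> box c d"
    unfolding mem_box
  proof
    fix i :: 'a assume i: "i \<in> Basis"
    show "c \<bullet> i < (x - y) \<bullet> i \<and> (x - y) \<bullet> i < d \<bullet> i"
      using lt[OF i, of "d \<bullet> i - c \<bullet> i"] assms(2)[OF i] unfolding inner_diff_left yi[OF i] t(3)[OF i] by linarith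
  qed
  ultimately show "x \<in> box a b + box c d"
    by (metis add.commute diff_add_cancel set_plus_intro)
qed

lemma brunn_minkowski_box:
  fixes a b c d :: "'a::euclidean_space"
  assumes "box a b \<noteq> {}" "box c d \<noteq> {}" and m: "box a b + box c d \<in> lmeasurable"
  shows "(root DIM('a) (measure lebesgue (box a b)) + root DIM('a) (measure lebesgue (box c d))) ^ DIM('a)
    \<le> measure lebesgue (box a b + box c d)"
proof -
  have ab: "a \<bullet> i < b \<bullet> i" and cd: "c \<bullet> i < d \<bullet> i" if "i \<in> Basis" for i
    using assms(1,2) that by (auto simp: box_ne_empty)
  have mb: "measure lebesgue (box u v) = (\<Prod>i\<in>Basis. (v - u) \<bullet> i)"
    if "\<And>i. i \<in> Basis \<Longrightarrow> u \<bullet> i < v \<bullet> i" for u v :: 'a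
    using that by (simp add: measure_lborel_box_eq less_imp_le)
  have s: "(a + c) \<bullet> i < (b + d) \<bullet> i" if "i \<in> Basis" for i
    using ab cd that by (simp add: inner_add_left add_strict_mono)
  have "root DIM('a) (measure lebesgue (box a b)) + root DIM('a) (measure lebesgue (box c d))
    \<le> root DIM('a) (\<Prod>i\<in>Basis. (b - a) \<bullet> i + (d - c) \<bullet> i)"
    using root_prod_add_le[of "Basis :: 'a set" "\<lambda>i. (b - a) \<bullet> i" "\<lambda>i. (d - c) \<bullet> i"] mb[of a b] mb[of c d] ab cd
    by (simp add: inner_diff_left)
  also have "(\<Prod>i\<in>Basis. (b - a) \<bullet> i + (d - c) \<bullet> i) = measure lebesgue (box (a + c) (b + d))"
    by (subst mb[OF s]) (auto intro!: prod.cong simp: inner_simps)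
  finally have "(root DIM('a) (measure lebesgue (box a b)) + root DIM('a) (measure lebesgue (box c d))) ^ DIM('a)
     \<le> root DIM('a) (measure lebesgue (box (a + c) (b + d))) ^ DIM('a)"
    by (intro power_mono) auto
  also have "\<dots> = measure lebesgue (box (a + c) (b + d))" by (simp add: real_root_pow_pos2)
  also have "\<dots> \<le> measure lebesgue (box a b + box c d)"
    using box_add_superset[OF ab cd] m by (intro measure_mono_fmeasurable) auto
  finally show ?thesis .
qed

section \<open>Brunn-Minkowski from unions of boxes to open sets and convex bodies\<close>

lemma open_set_plus:
  fixes X Y :: "'a::real_normed_vector set"
  assumes "open Y"
  shows "open (X + Y)"
proof -
  have "X + Y = (\<Union>x\<in>X. (+) x ` Y)" by (auto simp: set_plus_def)
  then show ?thesis using assms by (auto intro: open_translation)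
qed

lemma bounded_set_plus:
  fixes X Y :: "'a::real_normed_vector set"
  assumes "bounded X" "bounded Y"
  shows "bounded (X + Y)"
  using bounded_plus[OF assms] by (simp add: set_plus_image)

text \<open>Hadwiger and Ohmann's induction on the number of boxes: a hyperplane separating two boxes of one
  family, and a translate of it cutting the other family in the same volume ratio, reduce both halves
  to fewer boxes.\<close>
lemma brunn_minkowski_box_family:
  fixes F G :: "'a::euclidean_space set set"
  assumes "box_family F" "box_family G"
  shows "(root DIM('a) (measure lebesgue (\<Union>F)) + root DIM('a) (measure lebesgue (\<Union>G))) ^ DIM('a)
    \<le> measure lebesgue (\<Union>F + \<Union>G)"
  using assms
proof (induction "card F + card G" arbitrary: F G rule: less_induct)
  case less
  define \<beta> where "\<beta> X Y = (root DIM('a) (measure lebesgue X) + root DIM('a) (measure lebesgue Y)) ^ DIM('a)"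
    for X Y :: "'a set"
  have meas: "\<Union>F' + \<Union>G' \<in> lmeasurable" if "box_family F'" "box_family G'" for F' G' :: "'a set set"
    using that by (intro lmeasurable_open bounded_set_plus open_set_plus box_family_Union)
  \<comment> \<open>\<open>F'\<close> and \<open>G'\<close> are tied to \<open>F\<close> and
    \<open>G\<close> only through the total count, so the step also applies with the two families
    exchanged.\<close>
  have step: "\<beta> (\<Union>F') (\<Union>G') \<le> measure lebesgue (\<Union>F' + \<Union>G')"
    if F': "box_family F'" and G': "box_family G'" and card: "card F' + card G' = card F + card G"
      and two: "card F' \<ge> 2" for F' G' :: "'a set set"
  proof -
    obtain B C where BC: "B \<in> F'" "C \<in> F'" "B \<noteq> C"
      using two by (metis card_le_Suc0_iff_eq F' box_family_def not_less_eq_eq numeral_2_eq_2)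
    have bx: "\<exists>a b. B = box a b" if "B \<in> F'" for B using F' that by (simp add: box_family_def)
    obtain a b where ab: "B = box a b" using bx[OF BC(1)] by (elim exE)
    obtain c d where cd: "C = box c d" using bx[OF BC(2)] by (elim exE)
    note abcd = ab cd
    have "B \<inter> C = {}" "B \<noteq> {}" "C \<noteq> {}"
      using F' BC by (auto simp: box_family_def pairwise_def disjnt_def)
    then obtain i where i: "i \<in> Basis" "b \<bullet> i \<le> c \<bullet> i \<or> d \<bullet> i \<le> a \<bullet> i"
      using disjoint_boxes_separated[of a b c d] unfolding abcd by blast
    \<comment> \<open>The hyperplane at height \<open>e\<close> separates two boxes, so each of its
      open half-spaces misses a box of \<open>F'\<close>.\<close>
    obtain e where e: "(\<exists>B\<in>F'. B \<inter> {x. e < x \<bullet> i} = {}) \<and> (\<exists>B\<in>F'. B \<inter> {x. x \<bullet> i < e} = {})"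
    proof (cases "b \<bullet> i \<le> c \<bullet> i")
      case True
      then have "box a b \<inter> {x. c \<bullet> i < x \<bullet> i} = {}" "box c d \<inter> {x. x \<bullet> i < c \<bullet> i} = {}"
        using i by (force simp: box_def)+
      then show ?thesis using that BC unfolding abcd by blast
    next
      case False
      then have "box a b \<inter> {x. x \<bullet> i < a \<bullet> i} = {}" "box c d \<inter> {x. a \<bullet> i < x \<bullet> i} = {}"
        using i by (force simp: box_def)+
      then show ?thesis using that BC unfolding abcd by blast
    qed
    define X where "X = \<Union>F'"
    define Y where "Y = \<Union>G'"
    note XY = box_family_Union[OF F', folded X_def] box_family_Union[OF G', folded Y_def]
    define L where "L c = {x. x \<bullet> i < c}" for c
    define U where "U c = {x. c < x \<bullet> i}" for c
    have oLU: "open (L c)" "open (U c)" for c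
      by (auto simp: L_def U_def open_halfspace_component_lt open_halfspace_component_gt)
    have split: "measure lebesgue Z = measure lebesgue (Z \<inter> L c) + measure lebesgue (Z \<inter> U c)"
      if "Z \<in> lmeasurable" for Z c
      unfolding L_def U_def using that i by (intro measure_split_hyperplane)
    have boxLU: "\<exists>a' b'. box a b \<inter> L c = box a' b'" "\<exists>a' b'. box a b \<inter> U c = box a' b'" for a b c
      unfolding L_def U_def using i box_Int_halfspace_lt box_Int_halfspace_gt by blast+
    have pos: "0 < measure lebesgue (Z \<inter> H)" if "open Z" "bounded Z" "open H" "Z \<inter> H \<noteq> {}" for Z H :: "'a set"
    proof -
      have "\<not> negligible (Z \<inter> H)" using that by (intro open_not_negligible) auto
      moreover have "Z \<inter> H \<in> lmeasurable" using that by (intro lmeasurable_open) (auto intro: bounded_subset)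
      ultimately show ?thesis by (simp add: negligible_iff_measure zero_less_measure_iff)
    qed
    have F'ne: "\<And>B. B \<in> F' \<Longrightarrow> B \<noteq> {} \<and> open B" using F' unfolding box_family_def by (metis open_box)
    have hyp: "B \<inter> L c \<noteq> {} \<or> B \<inter> U c \<noteq> {}" if "open B" "B \<noteq> {}" for B c
    proof (rule ccontr)
      assume "\<not> ?thesis"
      then have "B \<subseteq> {x. x \<bullet> i = c}" unfolding L_def U_def by force
      then have "negligible B" using i(1) negligible_subset negligible_standard_hyperplane by blast
      then show False using that open_not_negligible by blast
    qed
    obtain P Q where PQ: "P \<in> F'" "P \<inter> U e = {}" "Q \<in> F'" "Q \<inter> L e = {}"
      using e unfolding L_def U_def by blast
    have "P \<inter> L e \<noteq> {}" "Q \<inter> U e \<noteq> {}"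
      using hyp[of P e] hyp[of Q e] F'ne[OF PQ(1)] F'ne[OF PQ(3)] PQ by simp_all
    then have ne: "X \<inter> L e \<noteq> {}" "X \<inter> U e \<noteq> {}"
      using PQ(1,3) unfolding X_def by blast+
    define l where "l = measure lebesgue (X \<inter> L e) / measure lebesgue X"
    have l: "0 < l" "l < 1" "measure lebesgue (X \<inter> L e) = l * measure lebesgue X"
       "measure lebesgue (X \<inter> U e) = (1 - l) * measure lebesgue X"
      using pos[of X "L e"] pos[of X "U e"] XY oLU ne split[of X e] by (auto simp: l_def field_simps)
    obtain f where f: "measure lebesgue (Y \<inter> L f) = l * measure lebesgue Y"
      using halfspace_volume_ivt[of Y i l] XY i l unfolding L_def by auto
    then have f': "measure lebesgue (Y \<inter> U f) = (1 - l) * measure lebesgue Y"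
      using split[of Y f] XY by (simp add: algebra_simps)
    have neY: "Y \<inter> L f \<noteq> {}" "Y \<inter> U f \<noteq> {}"
      using f f' l XY by (metis less_numeral_extra(3) measure_empty mult_pos_pos diff_gt_0_iff_gt)+
    have half: "\<beta> (X \<inter> H) (Y \<inter> H') \<le> measure lebesgue ((X \<inter> H) + (Y \<inter> H')) \<and> (X \<inter> H) + (Y \<inter> H') \<in> lmeasurable"
      if H: "\<And>a b. \<exists>a' b'. box a b \<inter> H = box a' b'" "\<exists>B\<in>F'. B \<inter> H = {}" "X \<inter> H \<noteq> {}"
        and H': "\<And>a b. \<exists>a' b'. box a b \<inter> H' = box a' b'" "Y \<inter> H' \<noteq> {}" for H H'
    proof -
      note 1 = box_family_Int[OF F' H(1) H(3)[unfolded X_def]]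
      note 2 = box_family_Int[OF G' H'(1) H'(2)[unfolded Y_def]]
      show ?thesis
        using less.hyps[OF _ 1(1) 2(1)] 1(4) 2(3) H(2) card meas[OF 1(1) 2(1)]
        unfolding 1(2) 2(2) \<beta>_def X_def Y_def by fastforce
    qed
    have lu: "(X \<inter> L e) + (Y \<inter> L f) \<in> lmeasurable" "(X \<inter> U e) + (Y \<inter> U f) \<in> lmeasurable"
      using half[of "L e" "L f"] half[of "U e" "U f"] boxLU e ne neY
      by (simp_all add: L_def[symmetric] U_def[symmetric])
    \<comment> \<open>\<beta> is homogeneous of degree 1 in the pair of volumes. As \<open>X\<close>
      and \<open>Y\<close> are cut in the same ratio \<open>l\<close> to \<open>1 - l\<close>, the
      values of \<beta> on the two halves add up to \<beta> of the whole without loss.\<close>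
    have scale: "(root DIM('a) (r * x) + root DIM('a) (r * y)) ^ DIM('a) = r * (root DIM('a) x + root DIM('a) y) ^ DIM('a)"
      if "0 \<le> r" for r x y
      using that by (simp add: real_root_mult distrib_left[symmetric] power_mult_distrib real_root_pow_pos2)
    have "\<beta> X Y = \<beta> (X \<inter> L e) (Y \<inter> L f) + \<beta> (X \<inter> U e) (Y \<inter> U f)"
      unfolding \<beta>_def l f f' using scale[of l] scale[of "1 - l"] l(1,2) by (simp add: left_diff_distrib)
    also have "\<dots> \<le> measure lebesgue ((X \<inter> L e) + (Y \<inter> L f)) + measure lebesgue ((X \<inter> U e) + (Y \<inter> U f))"
      using half[of "L e" "L f"] half[of "U e" "U f"] boxLU e ne neY
      by (simp add: L_def[symmetric] U_def[symmetric] add_mono)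
    also have "\<dots> = measure lebesgue (((X \<inter> L e) + (Y \<inter> L f)) \<union> ((X \<inter> U e) + (Y \<inter> U f)))"
    proof -
      \<comment> \<open>The hyperplane at height \<open>e + f\<close> separates the two
        sums.\<close>
      have "((X \<inter> L e) + (Y \<inter> L f)) \<inter> ((X \<inter> U e) + (Y \<inter> U f)) = {}"
      proof (rule ccontr)
        assume "\<not> ?thesis"
        then obtain x y x' y' where LU: "x \<in> L e" "y \<in> L f" "x' \<in> U e" "y' \<in> U f" and eq: "x + y = x' + y'"
          by (auto simp: set_plus_def)
        from LU have "(x + y) \<bullet> i < e + f" "e + f < (x' + y') \<bullet> i"
          by (auto simp: L_def U_def inner_add_left intro: add_strict_mono)
        then show False using eq by simp
      qed
      then show ?thesis
        using measure_Un3[OF lu] by simp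
    qed
    also have "\<dots> \<le> measure lebesgue (X + Y)"
    proof (intro measure_mono_fmeasurable)
      show "((X \<inter> L e) + (Y \<inter> L f)) \<union> ((X \<inter> U e) + (Y \<inter> U f)) \<subseteq> X + Y"
        by (auto simp: set_plus_def)
      show "((X \<inter> L e) + (Y \<inter> L f)) \<union> ((X \<inter> U e) + (Y \<inter> U f)) \<in> sets lebesgue"
        using lu by (intro fmeasurableD fmeasurable.Un)
      show "X + Y \<in> lmeasurable" unfolding X_def Y_def by (rule meas[OF F' G'])
    qed
    finally show ?thesis by (simp add: X_def Y_def)
  qed
  have fin: "finite F" "F \<noteq> {}" "finite G" "G \<noteq> {}" using less.prems by (auto simp: box_family_def)
  consider "card F \<ge> 2" | "card G \<ge> 2" | "card F = 1" "card G = 1"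
    using fin card_gt_0_iff[of F] card_gt_0_iff[of G] by linarith
  then have "\<beta> (\<Union>F) (\<Union>G) \<le> measure lebesgue (\<Union>F + \<Union>G)"
  proof cases
    case 1
    then show ?thesis using step less.prems by blast
  next
    case 2
    then have "\<beta> (\<Union>G) (\<Union>F) \<le> measure lebesgue (\<Union>G + \<Union>F)" using step[of G F] less.prems by simp
    then show ?thesis by (simp add: \<beta>_def add.commute)
  next
    case 3
    then obtain B C where BC: "F = {B}" "G = {C}" by (meson card_1_singletonE)
    then have "\<exists>a b. B = box a b" "\<exists>a b. C = box a b" and ne: "B \<noteq> {}" "C \<noteq> {}"
      using less.prems by (simp_all add: box_family_def)
    then obtain a b c d where abcd: "B = box a b" "C = box c d" by (elim exE)
    have "box a b + box c d \<in> lmeasurable" using meas[OF less.prems] by (simp add: BC abcd)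
    with ne show ?thesis unfolding \<beta>_def BC abcd cSup_singleton
      by (intro brunn_minkowski_box)
  qed
  then show ?case by (simp add: \<beta>_def)
qed

text \<open>An open set is a countable union of non-overlapping closed boxes. Finitely many of them
  carry all but \<open>e\<close> of the volume, and passing to their interiors loses only negligible
  frontiers.\<close>

lemma open_box_family_approx:
  fixes S :: "'a::euclidean_space set"
  assumes S: "open S" "bounded S" "S \<noteq> {}" and "0 < e"
  shows "\<exists>F. box_family F \<and> \<Union>F \<subseteq> S \<and> measure lebesgue S - e < measure lebesgue (\<Union>F)"
proof -
  obtain a where a: "S \<subseteq> cbox (-a) a" using S bounded_subset_cbox_symmetric by blast
  have "interior S \<subseteq> interior (cbox (-a) a)" using a by (rule interior_mono)
  then have ne: "box (-a) a \<noteq> {}" using S by (auto simp: interior_open)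
  \<comment> \<open>Each cell of the covering has a tag in \<open>S\<close> and lies in the gauge
    set of that tag, which is \<open>S\<close> itself; hence the cells do not leave
    \<open>S\<close>.\<close>
  have "gauge (\<lambda>x. if x \<in> S then S else UNIV)" using S by (auto simp: gauge_def)
  from covering_lemma[OF a ne this] obtain D where D: "countable D"
    "\<And>K. K \<in> D \<Longrightarrow> interior K \<noteq> {} \<and> (\<exists>c d. K = cbox c d)"
    "pairwise (\<lambda>A B. interior A \<inter> interior B = {}) D"
    "\<And>K. K \<in> D \<Longrightarrow> \<exists>x\<in>S \<inter> K. K \<subseteq> (if x \<in> S then S else UNIV)" "S \<subseteq> \<Union>D"
    by metis
  have US: "\<Union>D = S" using D(4,5) by fastforce
  then have Dne: "D \<noteq> {}" using S by auto
  define A where "A N = (\<Union>n\<le>N. from_nat_into D n)" for N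
  have inD: "from_nat_into D n \<in> D" for n using Dne by (rule from_nat_into)
  have mD: "K \<in> lmeasurable" "negligible (frontier K)" if "K \<in> D" for K
    using D(2)[OF that] by (auto intro: negligible_convex_frontier)
  have mA: "A N \<in> lmeasurable" for N
    unfolding A_def using inD mD by (intro fmeasurable.finite_UN) auto
  have UA: "(\<Union>N. A N) = S"
  proof -
    have "(\<Union>N. A N) = \<Union>(range (from_nat_into D))" unfolding A_def by auto
    then show ?thesis using range_from_nat_into[OF Dne D(1)] US by simp
  qed
  have "(\<lambda>N. measure lebesgue (A N)) \<longlonglongrightarrow> measure lebesgue (\<Union>N. A N)"
  proof (rule Lim_measure_incseq)
    show "range A \<subseteq> sets lebesgue" using mA by (auto simp: fmeasurableD)
    show "incseq A" by (auto simp: A_def incseq_def intro: order_trans)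
    have "S \<in> lmeasurable" using S by (simp add: lmeasurable_open)
    then show "emeasure lebesgue (\<Union>N. A N) \<noteq> \<infinity>" unfolding UA infinity_ennreal_def by (rule fmeasurableD2)
  qed
  then have "\<forall>\<^sub>F N in sequentially. measure lebesgue S - e < measure lebesgue (A N)"
    unfolding UA using \<open>0 < e\<close> by (intro order_tendstoD(1)) auto
  then obtain N where N: "measure lebesgue S - e < measure lebesgue (A N)"
    by (metis eventually_sequentially order_refl)
  define D' where "D' = from_nat_into D ` {..N}"
  define F where "F = interior ` D'"
  have D': "D' \<subseteq> D" "finite D'" "D' \<noteq> {}" using inD by (auto simp: D'_def)
  have "box_family F"
    unfolding box_family_def
  proof (intro conjI ballI)
    show "finite F" "F \<noteq> {}" using D' by (auto simp: F_def)
    have "pairwise (\<lambda>A B. interior A \<inter> interior B = {}) D'" using D(3) D'(1) by (rule pairwise_subset)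
    then show "disjoint F" unfolding F_def pairwise_image by (auto simp: pairwise_def disjnt_def)
    fix B assume "B \<in> F"
    then obtain K where K: "K \<in> D" "B = interior K" using D'(1) by (auto simp: F_def)
    have ne: "interior K \<noteq> {}" and "\<exists>c d. K = cbox c d" using D(2)[OF K(1)] by simp_all
    then obtain c d where "K = cbox c d" by (elim exE)
    with ne show "B \<noteq> {}" "\<exists>a b. B = box a b" using K(2) by (auto simp: interior_cbox)
  qed
  moreover have "\<Union>F \<subseteq> S" using D' US interior_subset unfolding F_def by fast
  moreover have "measure lebesgue (A N) = measure lebesgue (\<Union>F)"
  proof (rule measure_negligible_symdiff)
    show "\<Union>F \<in> lmeasurable" by (rule box_family_Union(3)[OF \<open>box_family F\<close>])
    have "negligible (\<Union>(frontier ` D'))" using D' mD by (intro negligible_Union) auto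
    moreover have "(\<Union>F - A N) \<union> (A N - \<Union>F) \<subseteq> \<Union>(frontier ` D')"
    proof -
      have "A N = \<Union>D'" unfolding A_def D'_def by auto
      moreover have "\<Union>F \<subseteq> \<Union>D'" unfolding F_def using interior_subset by fastforce
      moreover have "x \<in> frontier K" if "x \<in> K" "x \<notin> interior K" for x and K :: "'a set"
        using that closure_subset by (auto simp: frontier_def)
      ultimately show ?thesis unfolding F_def by auto
    qed
    ultimately show "negligible ((\<Union>F - A N) \<union> (A N - \<Union>F))" by (rule negligible_subset)
  qed
  ultimately show ?thesis using N by metis
qed

lemma brunn_minkowski_open:
  fixes U V :: "'a::euclidean_space set"
  assumes U: "open U" "bounded U" "U \<noteq> {}" and V: "open V" "bounded V" "V \<noteq> {}"
  shows "(root DIM('a) (measure lebesgue U) + root DIM('a) (measure lebesgue V)) ^ DIM('a) \<le> measure lebesgue (U + V)"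
proof (rule LIMSEQ_le_const2)
  \<comment> \<open>Truncation at 0 keeps the roots nonnegative, so that raising to the power
    DIM('a) stays monotone.\<close>
  define r where "r m = (root DIM('a) (max 0 (measure lebesgue U - 1 / real (Suc m))) + root DIM('a) (max 0 (measure lebesgue V - 1 / real (Suc m)))) ^ DIM('a)" for m
  have "(\<lambda>m. 1 / real (Suc m)) \<longlonglongrightarrow> 0" by (rule LIMSEQ_Suc[OF lim_1_over_n])
  then have "r \<longlonglongrightarrow> (root DIM('a) (max 0 (measure lebesgue U - 0)) + root DIM('a) (max 0 (measure lebesgue V - 0))) ^ DIM('a)"
    unfolding r_def by (intro tendsto_intros)
  then show "r \<longlonglongrightarrow> (root DIM('a) (measure lebesgue U) + root DIM('a) (measure lebesgue V)) ^ DIM('a)" by simp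
  have "r m \<le> measure lebesgue (U + V)" for m
  proof -
    have e: "0 < 1 / real (Suc m)" by simp
    obtain F where F: "box_family F" "\<Union>F \<subseteq> U" "measure lebesgue U - 1 / real (Suc m) < measure lebesgue (\<Union>F)"
      using open_box_family_approx[OF U e] by auto
    obtain G where G: "box_family G" "\<Union>G \<subseteq> V" "measure lebesgue V - 1 / real (Suc m) < measure lebesgue (\<Union>G)"
      using open_box_family_approx[OF V e] by auto
    have "r m \<le> (root DIM('a) (measure lebesgue (\<Union>F)) + root DIM('a) (measure lebesgue (\<Union>G))) ^ DIM('a)"
      unfolding r_def using F(3) G(3) by (intro power_mono add_mono) auto
    also have "\<dots> \<le> measure lebesgue (\<Union>F + \<Union>G)"
      using F(1) G(1) by (rule brunn_minkowski_box_family)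
    also have "\<dots> \<le> measure lebesgue (U + V)"
      using F G U V
      by (intro measure_mono_fmeasurable set_plus_mono2 fmeasurableD lmeasurable_open open_set_plus bounded_set_plus box_family_Union)
    finally show ?thesis .
  qed
  then show "\<exists>N. \<forall>n\<ge>N. r n \<le> measure lebesgue (U + V)" by blast
qed

lemma compact_set_plus:
  fixes X Y :: "'a::real_normed_vector set"
  assumes "compact X" "compact Y"
  shows "compact (X + Y)"
proof -
  have "X + Y = {x + y | x y. x \<in> X \<and> y \<in> Y}" by (auto simp: set_plus_def)
  then show ?thesis using compact_sums[OF assms] by simp
qed

lemma compact_sum_sets:
  fixes X :: "'i \<Rightarrow> 'a::real_normed_vector set"
  assumes "\<And>i. i \<in> S \<Longrightarrow> compact (X i)"
  shows "compact (\<Sum>i\<in>S. X i)"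
  using assms by (induction S rule: infinite_finite_induct) (auto simp: set_zero intro!: compact_set_plus)

lemma measure_interior_convex:
  fixes K :: "'a::euclidean_space set"
  assumes "bounded K" "convex K"
  shows "measure lebesgue (interior K) = measure lebesgue K"
  by (rule measure_interior[OF assms(1) negligible_convex_frontier[OF assms(2)]])

text \<open>Passing to interiors costs no volume, since the frontier of a convex set is negligible,
  and the open sum of the interiors lies in \<open>K + L\<close>.\<close>

lemma brunn_minkowski_convex:
  fixes K L :: "'a::euclidean_space set"
  assumes K: "compact K" "convex K" "interior K \<noteq> {}" and L: "compact L" "convex L" "interior L \<noteq> {}"
  shows "root DIM('a) (measure lebesgue K) + root DIM('a) (measure lebesgue L) \<le> root DIM('a) (measure lebesgue (K + L))"
proof -
  have b: "bounded K" "bounded L" using K L by (auto intro: compact_imp_bounded)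
  have "(root DIM('a) (measure lebesgue (interior K)) + root DIM('a) (measure lebesgue (interior L))) ^ DIM('a) \<le> measure lebesgue (interior K + interior L)"
    using K L b by (intro brunn_minkowski_open) (auto intro: bounded_interior)
  also have "\<dots> \<le> measure lebesgue (K + L)"
    using K L b by (intro measure_mono_fmeasurable set_plus_mono2 lmeasurable_compact compact_set_plus interior_subset)
      (auto intro!: lmeasurable_open open_set_plus bounded_set_plus fmeasurableD bounded_interior)
  finally have "root DIM('a) ((root DIM('a) (measure lebesgue K) + root DIM('a) (measure lebesgue L)) ^ DIM('a)) \<le> root DIM('a) (measure lebesgue (K + L))"
    unfolding measure_interior_convex[OF b(1) K(2)] measure_interior_convex[OF b(2) L(2)]
    by (intro real_root_le_mono) auto
  then show ?thesis by (simp add: real_root_power_cancel)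
qed

section \<open>Gradients of log-partition functions\<close>

definition partition_function :: "'a::euclidean_space set \<Rightarrow> 'a \<Rightarrow> real" where
  "partition_function P x = (\<Sum>v\<in>P. exp (x \<bullet> v))"

definition gibbs :: "'a::euclidean_space set \<Rightarrow> 'a \<Rightarrow> 'a \<Rightarrow> real" where
  "gibbs P x v = exp (x \<bullet> v) / partition_function P x"

text \<open>The weights \<open>gibbs P x\<close> form a probability distribution on
  \<open>P\<close>; its mean is the gradient of \<open>ln (partition_function P x)\<close>, and the
  derivative of the mean is the covariance of the distribution.\<close>

definition gibbs_mean :: "'a::euclidean_space set \<Rightarrow> 'a \<Rightarrow> 'a" where
  "gibbs_mean P x = (\<Sum>v\<in>P. gibbs P x v *\<^sub>R v)"

lemma partition_function_pos:
  assumes "finite P" "P \<noteq> {}"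
  shows "0 < partition_function P x"
  unfolding partition_function_def using assms by (intro sum_pos) auto

lemma gibbs_pos:
  assumes "finite P" "P \<noteq> {}"
  shows "0 < gibbs P x v"
  unfolding gibbs_def using partition_function_pos[OF assms] by simp

lemma sum_gibbs:
  assumes "finite P" "P \<noteq> {}"
  shows "(\<Sum>v\<in>P. gibbs P x v) = 1"
  unfolding gibbs_def using partition_function_pos[OF assms, of x]
  by (simp add: sum_divide_distrib[symmetric] partition_function_def)

lemma gibbs_mean_in_hull:
  assumes "finite P" "P \<noteq> {}"
  shows "gibbs_mean P x \<in> convex hull P"
  unfolding gibbs_mean_def using assms
  by (intro convex_sum) (auto simp: sum_gibbs gibbs_pos less_imp_le hull_inc)

text \<open>The log-partition function dominates the support function of the hull: one summand alone
  gives the bound at a vertex, and a half-space is convex. This is the source of coercivity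
  below.\<close>

lemma inner_le_ln_partition_function:
  assumes "finite P" "q \<in> convex hull P"
  shows "x \<bullet> q \<le> ln (partition_function P x)"
proof -
  have "x \<bullet> v \<le> ln (partition_function P x)" if "v \<in> P" for v
  proof -
    have "exp (x \<bullet> v) \<le> partition_function P x"
      unfolding partition_function_def using that assms by (intro member_le_sum) auto
    then have "ln (exp (x \<bullet> v)) \<le> ln (partition_function P x)"
      by (subst ln_le_cancel_iff) (auto intro: less_le_trans[OF exp_gt_zero])
    then show ?thesis by simp
  qed
  then have "convex hull P \<subseteq> {q. x \<bullet> q \<le> ln (partition_function P x)}"
    by (intro hull_minimal) (auto simp: convex_halfspace_le)
  then show ?thesis using assms by auto
qed

lemma has_derivative_partition_function:
  assumes "finite P" "P \<noteq> {}"
  shows "(partition_function P has_derivative (\<lambda>h. partition_function P x * (gibbs_mean P x \<bullet> h))) (at x)"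
proof -
  have "(partition_function P has_derivative (\<lambda>h. \<Sum>v\<in>P. exp (x \<bullet> v) * (h \<bullet> v))) (at x)"
    unfolding partition_function_def by (auto intro!: derivative_eq_intros simp: mult.commute)
  moreover have "(\<Sum>v\<in>P. exp (x \<bullet> v) * (h \<bullet> v)) = partition_function P x * (gibbs_mean P x \<bullet> h)" for h
    using partition_function_pos[OF assms, of x]
    by (simp add: gibbs_mean_def gibbs_def inner_sum_right sum_distrib_left inner_commute)
  ultimately show ?thesis by simp
qed

lemma has_derivative_ln_partition_function:
  assumes "finite P" "P \<noteq> {}"
  shows "((\<lambda>x. ln (partition_function P x)) has_derivative (\<lambda>h. gibbs_mean P x \<bullet> h)) (at x)"
  using partition_function_pos[OF assms, of x]
  by (auto intro!: derivative_eq_intros has_derivative_partition_function[OF assms])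

lemma has_derivative_gibbs:
  assumes "finite P" "P \<noteq> {}"
  shows "((\<lambda>x. gibbs P x v) has_derivative (\<lambda>h. gibbs P x v * ((v - gibbs_mean P x) \<bullet> h))) (at x)"
proof -
  have "((\<lambda>x. exp (x \<bullet> v) / partition_function P x) has_derivative
     (\<lambda>h. (exp (x \<bullet> v) * (h \<bullet> v) * partition_function P x - exp (x \<bullet> v) * (partition_function P x * (gibbs_mean P x \<bullet> h)))
        / (partition_function P x * partition_function P x))) (at x)"
    using partition_function_pos[OF assms, of x]
    by (auto intro!: derivative_eq_intros has_derivative_partition_function[OF assms])
  then show ?thesis
    unfolding gibbs_def
  proof (rule has_derivative_eq_rhs, intro ext)
    fix h
    show "(exp (x \<bullet> v) * (h \<bullet> v) * partition_function P x - exp (x \<bullet> v) * (partition_function P x * (gibbs_mean P x \<bullet> h)))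
        / (partition_function P x * partition_function P x) = exp (x \<bullet> v) / partition_function P x * ((v - gibbs_mean P x) \<bullet> h)"
      using partition_function_pos[OF assms, of x]
      by (simp add: inner_diff_left inner_commute[of h v] field_simps)
  qed
qed

text \<open>Differentiating the weights leaves the plain vectors \<open>v\<close> as second factors.
  Replacing them by \<open>v - gibbs_mean P x\<close> changes nothing, because weighted deviations
  from the mean sum to zero; only this symmetric form is a Gram matrix.\<close>

lemma has_derivative_gibbs_mean:
  assumes "finite P" "P \<noteq> {}"
  shows "(gibbs_mean P has_derivative
    (\<lambda>h. \<Sum>v\<in>P. (gibbs P x v * ((v - gibbs_mean P x) \<bullet> h)) *\<^sub>R (v - gibbs_mean P x))) (at x)"
proof -
  have "((\<lambda>x. \<Sum>v\<in>P. gibbs P x v *\<^sub>R v) has_derivative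
    (\<lambda>h. \<Sum>v\<in>P. (gibbs P x v * ((v - gibbs_mean P x) \<bullet> h)) *\<^sub>R v)) (at x)"
    by (auto intro!: derivative_eq_intros has_derivative_gibbs[OF assms])
  moreover have "(\<Sum>v\<in>P. (gibbs P x v * ((v - gibbs_mean P x) \<bullet> h)) *\<^sub>R gibbs_mean P x) = 0" for h
  proof -
    have "(\<Sum>v\<in>P. gibbs P x v * ((v - gibbs_mean P x) \<bullet> h))
       = (\<Sum>v\<in>P. gibbs P x v * (v \<bullet> h)) - (\<Sum>v\<in>P. gibbs P x v) * (gibbs_mean P x \<bullet> h)"
      by (simp add: inner_diff_left right_diff_distrib sum_subtractf sum_distrib_right)
    also have "\<dots> = 0"
      by (simp add: sum_gibbs[OF assms] gibbs_mean_def inner_sum_left)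
    finally show ?thesis by (simp add: scaleR_sum_left[symmetric])
  qed
  ultimately show ?thesis
    unfolding gibbs_mean_def[abs_def, symmetric]
    by (simp add: scaleR_right_diff_distrib sum_subtractf gibbs_mean_def[abs_def])
qed

section \<open>The gradient map of a weighted family of polytopes\<close>

locale full_polytopes =
  fixes J :: "'j set" and P :: "'j \<Rightarrow> 'a::euclidean_space set"
  assumes J: "finite J"
    and P: "\<And>j. j \<in> J \<Longrightarrow> finite (P j)" "\<And>j. j \<in> J \<Longrightarrow> interior (convex hull P j) \<noteq> {}"
begin

lemma P_nonempty: "j \<in> J \<Longrightarrow> P j \<noteq> {}"
  using P(2) by force

definition minkowski_comb :: "('j \<Rightarrow> real) \<Rightarrow> 'a set" where
  "minkowski_comb a = (\<Sum>j\<in>J. (\<lambda>x. a j *\<^sub>R x) ` (convex hull P j))"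

text \<open>\<open>mean_map a\<close> is the gradient of the convex function \<open>\<Sum>j\<in>J. a j * ln (partition_function (P j) x)\<close>.\<close>
definition mean_map :: "('j \<Rightarrow> real) \<Rightarrow> 'a \<Rightarrow> 'a" where
  "mean_map a x = (\<Sum>j\<in>J. a j *\<^sub>R gibbs_mean (P j) x)"

definition mean_map_deriv :: "('j \<Rightarrow> real) \<Rightarrow> 'a \<Rightarrow> 'a \<Rightarrow> 'a" where
  "mean_map_deriv a x h = (\<Sum>j\<in>J. a j *\<^sub>R (\<Sum>v\<in>P j.
     (gibbs (P j) x v * ((v - gibbs_mean (P j) x) \<bullet> h)) *\<^sub>R (v - gibbs_mean (P j) x)))"

lemma has_derivative_mean_map: "(mean_map a has_derivative mean_map_deriv a x) (at x)"
  unfolding mean_map_def[abs_def] mean_map_deriv_def[abs_def]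
  using P P_nonempty
  by (intro has_derivative_sum has_derivative_scaleR_right has_derivative_gibbs_mean) auto

lemma mean_map_deriv_inner:
  "mean_map_deriv a x h \<bullet> h = (\<Sum>j\<in>J. a j * (\<Sum>v\<in>P j. gibbs (P j) x v * ((v - gibbs_mean (P j) x) \<bullet> h)\<^sup>2))"
  by (simp add: mean_map_deriv_def inner_sum_left power2_eq_square mult.assoc)

text \<open>The quadratic form is a weighted sum of variances in direction \<open>h\<close>. A zero
  variance would put all of \<open>P j\<close> into one hyperplane orthogonal to \<open>h\<close>,
  and the hull would have no interior.\<close>

lemma mean_map_deriv_pos:
  assumes a: "\<And>j. j \<in> J \<Longrightarrow> 0 \<le> a j" "\<exists>j\<in>J. 0 < a j" and "h \<noteq> 0"
  shows "0 < mean_map_deriv a x h \<bullet> h"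
proof -
  have nn: "0 \<le> (\<Sum>v\<in>P j. gibbs (P j) x v * ((v - gibbs_mean (P j) x) \<bullet> h)\<^sup>2)" if "j \<in> J" for j
    using that P P_nonempty by (intro sum_nonneg mult_nonneg_nonneg) (auto intro: less_imp_le gibbs_pos)
  obtain j where j: "j \<in> J" "0 < a j" using a by blast
  have "\<exists>v\<in>P j. (v - gibbs_mean (P j) x) \<bullet> h \<noteq> 0"
  proof (rule ccontr)
    assume "\<not> ?thesis"
    then have "P j \<subseteq> {v. h \<bullet> v = h \<bullet> gibbs_mean (P j) x}" by (auto simp: inner_diff_right inner_commute)
    then have "convex hull P j \<subseteq> {v. h \<bullet> v = h \<bullet> gibbs_mean (P j) x}"
      by (intro hull_minimal) (auto simp: convex_hyperplane)
    then have "interior (convex hull P j) \<subseteq> {}"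
      using interior_mono interior_hyperplane[OF \<open>h \<noteq> 0\<close>] by metis
    then show False using P(2) j by blast
  qed
  then obtain w where w: "w \<in> P j" "(w - gibbs_mean (P j) x) \<bullet> h \<noteq> 0" by blast
  have "0 < (\<Sum>v\<in>P j. gibbs (P j) x v * ((v - gibbs_mean (P j) x) \<bullet> h)\<^sup>2)"
    using w j P P_nonempty
    by (intro sum_pos2[of _ w]) (auto intro!: mult_pos_pos mult_nonneg_nonneg gibbs_pos less_imp_le[OF gibbs_pos])
  then show ?thesis
    unfolding mean_map_deriv_inner using j J a nn
    by (intro sum_pos2[of _ j]) auto
qed

text \<open>Along the segment from \<open>y\<close> to \<open>x\<close> the component of the map in
  direction \<open>x - y\<close> increases strictly, so the end values differ.\<close>

lemma inj_mean_map:
  assumes a: "\<And>j. j \<in> J \<Longrightarrow> 0 \<le> a j" "\<exists>j\<in>J. 0 < a j"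
  shows "inj (mean_map a)"
proof (rule injI, rule ccontr)
  fix x y assume eq: "mean_map a x = mean_map a y" and "x \<noteq> y"
  define h where "h = x - y"
  have "h \<noteq> 0" using \<open>x \<noteq> y\<close> by (simp add: h_def)
  define g where "g t = mean_map a (y + t *\<^sub>R h) \<bullet> h" for t :: real
  have der: "(g has_real_derivative (mean_map_deriv a (y + t *\<^sub>R h) h \<bullet> h)) (at t)" for t
  proof -
    have "(mean_map a \<circ> (\<lambda>t. y + t *\<^sub>R h) has_derivative mean_map_deriv a (y + t *\<^sub>R h) \<circ> (\<lambda>s. s *\<^sub>R h)) (at t)"
      by (rule diff_chain_at) (auto intro!: derivative_eq_intros has_derivative_mean_map)
    then have "(g has_derivative (\<lambda>s. mean_map_deriv a (y + t *\<^sub>R h) (s *\<^sub>R h) \<bullet> h)) (at t)"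
      unfolding g_def o_def by (rule has_derivative_inner_left)
    moreover have "linear (mean_map_deriv a (y + t *\<^sub>R h))"
      using has_derivative_linear[OF has_derivative_mean_map] .
    ultimately show ?thesis
      unfolding has_field_derivative_def by (simp add: linear_scale mult.commute[of _ "_ \<bullet> _"])
  qed
  have "g 0 < g 1"
    by (rule DERIV_pos_imp_increasing) (use der mean_map_deriv_pos[OF a \<open>h \<noteq> 0\<close>] in force)+
  then show False using eq by (simp add: g_def h_def)
qed

lemma mean_map_in: "mean_map a x \<in> minkowski_comb a"
  unfolding minkowski_comb_def set_sum_alt[OF J] mean_map_def
  by (auto intro!: exI imageI gibbs_mean_in_hull P P_nonempty)

text \<open>A variational argument: the potential minus the linear form given by \<open>y\<close> is
  coercive, hence has a minimum, and there the critical point equation reads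
  \<open>mean_map a z = y\<close>.\<close>

lemma interior_subset_range_mean_map:
  assumes a: "\<And>j. j \<in> J \<Longrightarrow> 0 \<le> a j"
  shows "interior (minkowski_comb a) \<subseteq> range (mean_map a)"
proof
  fix y assume "y \<in> interior (minkowski_comb a)"
  then obtain d where d: "0 < d" "cball y d \<subseteq> minkowski_comb a" by (auto simp: mem_interior_cball)
  define \<psi> where "\<psi> x = (\<Sum>j\<in>J. a j * ln (partition_function (P j) x)) - x \<bullet> y" for x
  have der: "(\<psi> has_derivative (\<lambda>h. (mean_map a x - y) \<bullet> h)) (at x)" for x
  proof -
    have "((\<lambda>x. (\<Sum>j\<in>J. a j * ln (partition_function (P j) x)) - x \<bullet> y) has_derivative
        (\<lambda>h. (\<Sum>j\<in>J. a j * (gibbs_mean (P j) x \<bullet> h)) - h \<bullet> y)) (at x)"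
      using P P_nonempty
      by (intro has_derivative_diff has_derivative_sum has_derivative_mult_right
           has_derivative_ln_partition_function has_derivative_inner_left has_derivative_ident) auto
    then show ?thesis unfolding \<psi>_def
      by (rule has_derivative_eq_rhs) (simp add: mean_map_def inner_diff_right inner_sum_right inner_commute)
  qed
  have supp: "x \<bullet> q \<le> (\<Sum>j\<in>J. a j * ln (partition_function (P j) x))" if q: "q \<in> minkowski_comb a" for q x
  proof -
    obtain s where s: "q = sum s J" "\<forall>j\<in>J. s j \<in> (\<lambda>x. a j *\<^sub>R x) ` (convex hull P j)"
      using q unfolding minkowski_comb_def set_sum_alt[OF J] by auto
    have "x \<bullet> s j \<le> a j * ln (partition_function (P j) x)" if "j \<in> J" for j
    proof -
      have "s j \<in> (\<lambda>x. a j *\<^sub>R x) ` (convex hull P j)" using s(2) that by simp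
      then obtain p where "p \<in> convex hull P j" "s j = a j *\<^sub>R p" by auto
      then show ?thesis using inner_le_ln_partition_function[OF P(1)[OF that], of p x] a[OF that]
        by (simp add: mult_left_mono)
    qed
    then show ?thesis unfolding s(1) inner_sum_right by (rule sum_mono)
  qed
  have coer: "d * norm x \<le> \<psi> x" for x
  proof (cases "x = 0")
    case True
    then show ?thesis using supp[of y 0] d(1) subsetD[OF d(2), of y] by (simp add: \<psi>_def)
  next
    case False
    \<comment> \<open>The point of the ball around \<open>y\<close> that is farthest in direction
      \<open>x\<close>; the support inequality there gains \<open>d * norm x\<close> over
      \<open>y\<close>.\<close>
    have "y + (d / norm x) *\<^sub>R x \<in> cball y d" using False d(1) by (simp add: dist_norm)
    from supp[OF subsetD[OF d(2) this], of x] show ?thesis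
      using False by (simp add: \<psi>_def inner_add_right power2_norm_eq_inner[symmetric] power2_eq_square)
  qed
  \<comment> \<open>By coercivity \<psi> is at least \<open>d * R\<close>, the value at the origin,
    outside the ball of this radius; so a minimum over the ball is global.\<close>
  define R where "R = \<psi> 0 / d"
  have "continuous_on (cball 0 R) \<psi>"
    using der by (meson continuous_at_imp_continuous_on has_derivative_continuous)
  moreover have "0 \<le> R" using coer[of 0] d by (simp add: R_def)
  ultimately obtain z where z: "z \<in> cball 0 R" "\<And>x. x \<in> cball 0 R \<Longrightarrow> \<psi> z \<le> \<psi> x"
    using continuous_attains_inf[of "cball 0 R" \<psi>] by auto
  have "\<psi> z \<le> \<psi> x" for x
  proof (cases "norm x \<le> R")
    case True
    then show ?thesis using z by (simp add: dist_norm)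
  next
    case False
    have "\<psi> z \<le> \<psi> 0" using z \<open>0 \<le> R\<close> by simp
    also have "\<dots> = d * R" using d by (simp add: R_def)
    also have "\<dots> \<le> d * norm x" using False d by (intro mult_left_mono) auto
    also have "\<dots> \<le> \<psi> x" by (rule coer)
    finally show ?thesis .
  qed
  then have "(\<lambda>h. (mean_map a z - y) \<bullet> h) = (\<lambda>h. 0)"
    using differential_zero_maxmin[OF _ open_UNIV der, of z] by blast
  then have "mean_map a z = y" by (metis eq_iff_diff_eq_0 inner_eq_zero_iff)
  then show "y \<in> range (mean_map a)" by blast
qed

lemma compact_convex_minkowski_comb: "compact (minkowski_comb a)" "convex (minkowski_comb a)"
proof -
  show "convex (minkowski_comb a)"
    unfolding minkowski_comb_def by (intro convex_set_sum) (auto intro: convex_scaling)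
  show "compact (minkowski_comb a)"
    unfolding minkowski_comb_def using P(1)
    by (intro compact_sum_sets compact_scaling finite_imp_compact_convex_hull)
qed

lemma range_mean_map_symdiff:
  assumes "\<And>j. j \<in> J \<Longrightarrow> 0 \<le> a j"
  shows "negligible (minkowski_comb a - range (mean_map a) \<union> (range (mean_map a) - minkowski_comb a))"
proof (rule negligible_subset)
  show "negligible (frontier (minkowski_comb a))"
    using compact_convex_minkowski_comb by (intro negligible_convex_frontier)
  show "minkowski_comb a - range (mean_map a) \<union> (range (mean_map a) - minkowski_comb a) \<subseteq> frontier (minkowski_comb a)"
  proof -
    have "range (mean_map a) \<subseteq> minkowski_comb a" using mean_map_in by auto
    then show ?thesis
      using interior_subset_range_mean_map[of a] assms closure_subset[of "minkowski_comb a"]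
      unfolding frontier_def by auto
  qed
qed

end

section \<open>Polynomiality of the volume\<close>

lemma functions_into_eq_PiE: "{f. \<forall>k. f k \<in> S k} = PiE UNIV S"
  by (auto simp: PiE_def Pi_def)

lemma finite_functions_into: "finite {f :: 'n::finite \<Rightarrow> 'b. \<forall>k. f k \<in> S k}" if "\<And>k. finite (S k)"
  unfolding functions_into_eq_PiE using that by (simp add: finite_PiE)

lemma det_sum_rows:
  fixes b :: "'n::finite \<Rightarrow> 'i \<Rightarrow> 'c::comm_ring_1^'n"
  assumes "finite I"
  shows "det (\<chi> r. \<Sum>i\<in>I. b r i) = (\<Sum>s\<in>{s. \<forall>k. s k \<in> I}. det (\<chi> r. b r (s r)))"
proof -
  have "det (\<chi> r. \<Sum>i\<in>I. b r i) = (\<Sum>p | p permutes UNIV. of_int (sign p) * (\<Prod>r\<in>UNIV. \<Sum>i\<in>I. b r i $ p r))"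
    by (simp add: det_def sum_component)
  also have "\<dots> = (\<Sum>p | p permutes UNIV. \<Sum>s\<in>{s. \<forall>k. s k \<in> I}. of_int (sign p) * (\<Prod>r\<in>UNIV. b r (s r) $ p r))"
    using assms by (simp add: prod_sum_PiE functions_into_eq_PiE[of "\<lambda>_. I"] sum_distrib_left)
  also have "\<dots> = (\<Sum>s\<in>{s. \<forall>k. s k \<in> I}. \<Sum>p | p permutes UNIV. of_int (sign p) * (\<Prod>r\<in>UNIV. b r (s r) $ p r))"
    by (rule sum.swap)
  finally show ?thesis by (simp add: det_def)
qed

text \<open>The Cauchy-Binet formula, summed over all families of n indices instead of n-element
  sets, which accounts for the factorial. Expansion by rows gives one determinant times a diagonal
  product; summation over all permutations of the family turns that product into a second
  determinant.\<close>

lemma det_gram_sum: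
  fixes u :: "'i \<Rightarrow> real^'n::finite" and w :: "'i \<Rightarrow> real"
  assumes "finite I"
  shows "fact CARD('n) * det (\<chi> r c. \<Sum>i\<in>I. w i * u i $ r * u i $ c)
    = (\<Sum>s\<in>{s :: 'n \<Rightarrow> 'i. \<forall>k. s k \<in> I}. (\<Prod>k\<in>UNIV. w (s k)) * (det (\<chi> k. u (s k)))\<^sup>2)"
proof -
  let ?S = "{s :: 'n \<Rightarrow> 'i. \<forall>k. s k \<in> I}"
  let ?Pm = "{p. p permutes (UNIV :: 'n set)}"
  let ?D = "det (\<chi> r c. \<Sum>i\<in>I. w i * u i $ r * u i $ c)"
  define f where "f s = (\<Prod>k\<in>UNIV. w (s k) * u (s k) $ k) * det (\<chi> k. u (s k))" for s
  have "?D = det (\<chi> r. \<Sum>i\<in>I. (w i * u i $ r) *s u i)"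
    by (rule arg_cong[where f = det]) (simp add: vec_eq_iff)
  also have "\<dots> = (\<Sum>s\<in>?S. det (\<chi> r. (w (s r) * u (s r) $ r) *s u (s r)))"
    by (rule det_sum_rows[OF assms])
  also have "\<dots> = (\<Sum>s\<in>?S. f s)"
    unfolding f_def det_rows_mul by simp
  finally have D: "?D = (\<Sum>s\<in>?S. f s)" .
  have inv_p: "s \<circ> inv p \<circ> p = s" "s \<circ> p \<circ> inv p = s" if "p permutes UNIV" for p and s :: "'n \<Rightarrow> 'i"
    using permutes_inverses[OF that] by (simp_all add: fun_eq_iff)
  \<comment> \<open>Composition with \<open>p\<close> only permutes the families, so every
    \<open>p\<close> yields the same total.\<close>
  have Dp: "?D = (\<Sum>s\<in>?S. f (s \<circ> p))" if p: "p permutes UNIV" for p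
    unfolding D
    by (rule sum.reindex_bij_witness[where i = "\<lambda>s. s \<circ> p" and j = "\<lambda>s. s \<circ> inv p"])
      (auto simp: inv_p[OF p])
  have fp: "f (s \<circ> p) = (\<Prod>k\<in>UNIV. w (s k)) * det (\<chi> k. u (s k)) * (of_int (sign p) * (\<Prod>k\<in>UNIV. u (s (p k)) $ k))"
    if p: "p permutes UNIV" for p s
  proof -
    have "det (\<chi> k. u (s (p k))) = of_int (sign p) * det (\<chi> k. u (s k))"
      using det_permute_rows[OF p, of "\<chi> k. u (s k)"] by simp
    moreover have "(\<Prod>k\<in>UNIV. w (s (p k))) = (\<Prod>k\<in>UNIV. w (s k))"
      using prod.permute[OF p, of "\<lambda>k. w (s k)"] by (simp add: o_def)
    ultimately show ?thesis by (simp add: f_def prod.distrib)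
  qed
  have detT: "(\<Sum>p\<in>?Pm. of_int (sign p) * (\<Prod>k\<in>UNIV. u (s (p k)) $ k)) = det (\<chi> k. u (s k))" for s
    by (subst det_transpose[symmetric]) (simp add: det_def transpose_def)
  have "fact CARD('n) * ?D = (\<Sum>p\<in>?Pm. ?D)"
    by (simp add: card_permutations[OF refl])
  also have "\<dots> = (\<Sum>p\<in>?Pm. \<Sum>s\<in>?S. f (s \<circ> p))"
    by (intro sum.cong refl Dp) auto
  also have "\<dots> = (\<Sum>s\<in>?S. \<Sum>p\<in>?Pm. f (s \<circ> p))" by (rule sum.swap)
  also have "\<dots> = (\<Sum>s\<in>?S. (\<Prod>k\<in>UNIV. w (s k)) * (det (\<chi> k. u (s k)))\<^sup>2)"
  proof (intro sum.cong refl)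
    fix s
    have "(\<Sum>p\<in>?Pm. f (s \<circ> p)) = (\<Sum>p\<in>?Pm. (\<Prod>k\<in>UNIV. w (s k)) * det (\<chi> k. u (s k)) * (of_int (sign p) * (\<Prod>k\<in>UNIV. u (s (p k)) $ k)))"
      by (intro sum.cong refl fp) auto
    then show "(\<Sum>p\<in>?Pm. f (s \<circ> p)) = (\<Prod>k\<in>UNIV. w (s k)) * (det (\<chi> k. u (s k)))\<^sup>2"
      unfolding sum_distrib_left[symmetric] detT by (simp add: power2_eq_square)
  qed
  finally show ?thesis .
qed

text \<open>The coefficient of \<open>\<Prod>k. a (t k)\<close> in the Jacobian determinant of \<open>mean_map a\<close>.\<close>
definition mixed_density :: "('j \<Rightarrow> (real^'n::finite) set) \<Rightarrow> ('n \<Rightarrow> 'j) \<Rightarrow> real^'n \<Rightarrow> real" where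
  "mixed_density P t x = (\<Sum>s\<in>{s. \<forall>k. s k \<in> P (t k)}.
     (\<Prod>k\<in>UNIV. gibbs (P (t k)) x (s k)) * (det (\<chi> k. s k - gibbs_mean (P (t k)) x))\<^sup>2) / fact CARD('n)"

text \<open>A permutation of the slots permutes the rows of the determinant, and the sign disappears
  in the square.\<close>

lemma mixed_density_permute:
  assumes p: "p permutes UNIV"
  shows "mixed_density P (t \<circ> p) x = mixed_density P t x"
proof -
  let ?g = "\<lambda>t s. (\<Prod>k\<in>UNIV. gibbs (P (t k)) x (s k)) * (det (\<chi> k. s k - gibbs_mean (P (t k)) x))\<^sup>2"
  have g: "?g (t \<circ> p) (s \<circ> p) = ?g t s" for s
  proof -
    have "det (\<chi> k. s (p k) - gibbs_mean (P (t (p k))) x) = of_int (sign p) * det (\<chi> k. s k - gibbs_mean (P (t k)) x)"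
      using det_permute_rows[OF p, of "\<chi> k. s k - gibbs_mean (P (t k)) x"] by simp
    moreover have "(of_int (sign p))\<^sup>2 = (1 :: real)" by (simp add: sign_def)
    moreover have "(\<Prod>k\<in>UNIV. gibbs (P (t (p k))) x (s (p k))) = (\<Prod>k\<in>UNIV. gibbs (P (t k)) x (s k))"
      using prod.permute[OF p, of "\<lambda>k. gibbs (P (t k)) x (s k)"] by (simp add: o_def)
    ultimately show ?thesis by (simp add: power_mult_distrib)
  qed
  have "(\<Sum>s\<in>{s. \<forall>k. s k \<in> P (t k)}. ?g t s) = (\<Sum>s\<in>{s. \<forall>k. s k \<in> P ((t \<circ> p) k)}. ?g (t \<circ> p) s)"
  proof (rule sum.reindex_bij_witness[where i = "\<lambda>s. s \<circ> inv p" and j = "\<lambda>s. s \<circ> p"])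
    fix s assume "s \<in> {s. \<forall>k. s k \<in> P ((t \<circ> p) k)}"
    then have "s (inv p k) \<in> P (t (p (inv p k)))" for k by simp
    then show "s \<circ> inv p \<in> {s. \<forall>k. s k \<in> P (t k)}" by (simp add: permutes_inverses[OF p])
  next
    fix s
    show "?g (t \<circ> p) (s \<circ> p) = ?g t s" by (rule g)
  qed (auto simp: fun_eq_iff permutes_inverses[OF p])
  then show ?thesis by (simp add: mixed_density_def)
qed

lemma mixed_density_nonneg:
  assumes "\<And>k. finite (P (t k))" "\<And>k. P (t k) \<noteq> {}"
  shows "0 \<le> mixed_density P t x"
  unfolding mixed_density_def
  by (intro divide_nonneg_nonneg sum_nonneg mult_nonneg_nonneg prod_nonneg ballI less_imp_le[OF gibbs_pos] assms) auto

lemma continuous_on_det [continuous_intros]: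
  fixes f :: "'a::topological_space \<Rightarrow> real^'n^'n::finite"
  assumes "continuous_on S f"
  shows "continuous_on S (\<lambda>x. det (f x))"
  unfolding det_def using assms by (intro continuous_intros)

lemma continuous_on_mixed_density:
  assumes "\<And>k. finite (P (t k))" "\<And>k. P (t k) \<noteq> {}"
  shows "continuous_on S (mixed_density P t)"
proof -
  have g: "continuous_on S (\<lambda>x. gibbs (P (t k)) x v)" for k v
    using has_derivative_gibbs[OF assms(1)[of k] assms(2)[of k]]
    by (meson continuous_at_imp_continuous_on has_derivative_continuous)
  have m: "continuous_on S (\<lambda>x. gibbs_mean (P (t k)) x)" for k
    using has_derivative_gibbs_mean[OF assms(1)[of k] assms(2)[of k]]
    by (meson continuous_at_imp_continuous_on has_derivative_continuous)
  show ?thesis unfolding mixed_density_def[abs_def]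
    by (intro continuous_intros g continuous_on_vec_lambda m) auto
qed

text \<open>The Jacobian matrix is a sum of rank-one matrices over the pairs of a label
  \<open>j\<close> and a point of \<open>P j\<close>. A family of n such pairs splits into labels
  \<open>t\<close> and points \<open>s\<close>; collecting by \<open>t\<close> isolates the
  monomials in \<open>a\<close>.\<close>

lemma det_mean_map_deriv:
  fixes P :: "'j \<Rightarrow> (real^'n::finite) set"
  assumes "full_polytopes J P"
  shows "det (matrix (full_polytopes.mean_map_deriv J P a x)) =
    (\<Sum>t\<in>{t :: 'n \<Rightarrow> 'j. \<forall>k. t k \<in> J}. (\<Prod>k\<in>UNIV. a (t k)) * mixed_density P t x)"
proof -
  interpret full_polytopes J P by fact
  let ?w = "\<lambda>(j, v). a j * gibbs (P j) x v"
  let ?u = "\<lambda>(j, v). v - gibbs_mean (P j) x"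
  let ?T = "{t :: 'n \<Rightarrow> 'j. \<forall>k. t k \<in> J}"
  let ?S = "\<lambda>t :: 'n \<Rightarrow> 'j. {s. \<forall>k. s k \<in> P (t k)}"
  have fin: "finite (Sigma J P)" using J P(1) by blast
  have mem_Sigma: "i \<in> Sigma J P \<longleftrightarrow> fst i \<in> J \<and> snd i \<in> P (fst i)" for i by (cases i) auto
  have "matrix (mean_map_deriv a x) = (\<chi> r c. \<Sum>i\<in>Sigma J P. ?w i * ?u i $ r * ?u i $ c)"
  proof (simp add: vec_eq_iff matrix_def, intro allI)
    fix r c :: 'n
    have "mean_map_deriv a x (axis c 1) $ r = (\<Sum>j\<in>J. \<Sum>v\<in>P j. a j * gibbs (P j) x v * ((v - gibbs_mean (P j) x) $ r) * ((v - gibbs_mean (P j) x) $ c))"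
      by (simp add: mean_map_deriv_def sum_component sum_distrib_left inner_axis mult_ac)
    also have "\<dots> = (\<Sum>i\<in>Sigma J P. ?w i * ?u i $ r * ?u i $ c)"
      using J P(1) by (subst sum.Sigma) (auto intro!: sum.cong)
    finally show "mean_map_deriv a x (axis c 1) $ r = (\<Sum>i\<in>Sigma J P. ?w i * ?u i $ r * ?u i $ c)" .
  qed
  then have "fact CARD('n) * det (matrix (mean_map_deriv a x)) =
      (\<Sum>s\<in>{s :: 'n \<Rightarrow> 'j \<times> (real^'n). \<forall>k. s k \<in> Sigma J P}. (\<Prod>k\<in>UNIV. ?w (s k)) * (det (\<chi> k. ?u (s k)))\<^sup>2)"
    using det_gram_sum[OF fin, of ?w ?u] by simp
  also have "\<dots> = (\<Sum>(t, s)\<in>Sigma ?T ?S. (\<Prod>k\<in>UNIV. a (t k)) *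
      ((\<Prod>k\<in>UNIV. gibbs (P (t k)) x (s k)) * (det (\<chi> k. s k - gibbs_mean (P (t k)) x))\<^sup>2))"
    by (rule sum.reindex_bij_witness[where j = "\<lambda>s. (fst \<circ> s, snd \<circ> s)" and i = "\<lambda>(t, s) k. (t k, s k)"])
      (auto simp: fun_eq_iff mem_Sigma case_prod_beta prod.distrib mult.assoc)
  also have "\<dots> = (\<Sum>t\<in>?T. \<Sum>s\<in>?S t. (\<Prod>k\<in>UNIV. a (t k)) *
      ((\<Prod>k\<in>UNIV. gibbs (P (t k)) x (s k)) * (det (\<chi> k. s k - gibbs_mean (P (t k)) x))\<^sup>2))"
    using J P(1) by (intro sum.Sigma[symmetric] finite_functions_into ballI) (auto intro: finite_functions_into)
  also have "\<dots> = fact CARD('n) * (\<Sum>t\<in>?T. (\<Prod>k\<in>UNIV. a (t k)) * mixed_density P t x)"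
    unfolding mixed_density_def by (subst sum_distrib_left) (simp add: sum_distrib_left[symmetric])
  finally show ?thesis by simp
qed

text \<open>\<open>I t\<close> is the integral of \<open>mixed_density P t\<close> over the whole
  space. The volume of the image is the integral of the Jacobian, and the densities do not involve
  \<open>a\<close>.\<close>

lemma volume_minkowski_comb_polynomial:
  fixes P :: "'j \<Rightarrow> (real^'n::{finite,wellorder}) set"
  assumes fp: "full_polytopes J P"
  obtains I :: "('n \<Rightarrow> 'j) \<Rightarrow> real" where
    "\<And>t. (\<And>k. t k \<in> J) \<Longrightarrow> 0 \<le> I t" "\<And>t p. p permutes UNIV \<Longrightarrow> I (t \<circ> p) = I t"
    "\<And>a. (\<And>j. j \<in> J \<Longrightarrow> 0 \<le> a j) \<Longrightarrow> measure lebesgue (\<Sum>j\<in>J. (\<lambda>x. a j *\<^sub>R x) ` (convex hull P j)) =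
       (\<Sum>t\<in>{t. \<forall>k. t k \<in> J}. (\<Prod>k\<in>UNIV. a (t k)) * I t)"
proof -
  interpret full_polytopes J P by fact
  let ?T = "{t :: 'n \<Rightarrow> 'j. \<forall>k. t k \<in> J}"
  have finT: "finite ?T" using J by (intro finite_functions_into)
  have nn: "0 \<le> mixed_density P t x" if "t \<in> ?T" for t x
    using that P(1) P_nonempty by (intro mixed_density_nonneg) auto
  have dnn: "0 \<le> det (matrix (mean_map_deriv a x))" if "\<And>j. j \<in> J \<Longrightarrow> 0 \<le> a j" for a x
    unfolding det_mean_map_deriv[OF fp] using that nn
    by (intro sum_nonneg mult_nonneg_nonneg prod_nonneg) auto
  have vol: "(\<lambda>x. det (matrix (mean_map_deriv a x))) integrable_on UNIV \<and>
      measure lebesgue (minkowski_comb a) = integral UNIV (\<lambda>x. det (matrix (mean_map_deriv a x)))"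
    if a: "\<And>j. j \<in> J \<Longrightarrow> 0 \<le> a j" "\<exists>j\<in>J. 0 < a j" for a
  proof -
    have lm: "minkowski_comb a \<in> lmeasurable" using compact_convex_minkowski_comb(1) by (rule lmeasurable_compact)
    note sd = range_mean_map_symdiff[of a, OF a(1)]
    have m: "measure lebesgue (range (mean_map a)) = measure lebesgue (minkowski_comb a)"
      using measure_negligible_symdiff[OF lm sd] .
    have r: "range (mean_map a) \<in> lmeasurable"
      using lmeasurable_negligible_symdiff[OF lm sd] .
    have abs: "(\<lambda>x. \<bar>det (matrix (mean_map_deriv a x))\<bar>) = (\<lambda>x. det (matrix (mean_map_deriv a x)))"
      using dnn[of a] a(1) by auto
    have "(\<lambda>x. det (matrix (mean_map_deriv a x))) integrable_on UNIV"
      using measurable_differentiable_image_eq[of UNIV "mean_map a" "mean_map_deriv a"]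
        has_derivative_mean_map inj_mean_map[of a, OF a] r by (simp add: abs)
    then show ?thesis
      using measure_differentiable_image_eq[of UNIV "mean_map a" "mean_map_deriv a"]
        has_derivative_mean_map inj_mean_map[of a, OF a] m by (simp add: abs)
  qed
  \<comment> \<open>With all weights equal to 1 each density is one of the nonnegative summands of
    the Jacobian, which is integrable because the image has finite measure; domination gives
    integrability of every summand.\<close>
  have int: "mixed_density P t integrable_on UNIV" if t: "t \<in> ?T" for t
  proof (rule measurable_bounded_by_integrable_imp_integrable)
    have "continuous_on UNIV (mixed_density P t)"
      using t P(1) P_nonempty by (intro continuous_on_mixed_density) auto
    then show "mixed_density P t \<in> borel_measurable (lebesgue_on UNIV)"
      by (intro continuous_imp_measurable_on_sets_lebesgue) auto
    have "\<exists>j. j \<in> J" using t by blast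
    then show "(\<lambda>x. det (matrix (mean_map_deriv (\<lambda>_. 1) x))) integrable_on UNIV" using vol[of "\<lambda>_. 1"] by auto
    show "norm (mixed_density P t x) \<le> det (matrix (mean_map_deriv (\<lambda>_. 1) x))" for x
      unfolding det_mean_map_deriv[OF fp] using nn[OF t] member_le_sum[OF t _ finT, of "\<lambda>t. mixed_density P t x"] nn
      by simp
  qed auto
  show ?thesis
  proof
    show "0 \<le> integral UNIV (mixed_density P t)" if "\<And>k. t k \<in> J" for t
      using that by (intro integral_nonneg int nn) auto
    show "integral UNIV (mixed_density P (t \<circ> p)) = integral UNIV (mixed_density P t)" if "p permutes UNIV" for t p
      using mixed_density_permute[OF that, of P t] by (metis ext)
    fix a :: "'j \<Rightarrow> real" assume a: "\<And>j. j \<in> J \<Longrightarrow> 0 \<le> a j"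
    have "measure lebesgue (minkowski_comb a) = (\<Sum>t\<in>?T. (\<Prod>k\<in>UNIV. a (t k)) * integral UNIV (mixed_density P t))"
    proof (cases "\<exists>j\<in>J. 0 < a j")
      case True
      have "measure lebesgue (minkowski_comb a) = integral UNIV (\<lambda>x. \<Sum>t\<in>?T. (\<Prod>k\<in>UNIV. a (t k)) * mixed_density P t x)"
        using vol[of a, OF a True] by (simp add: det_mean_map_deriv[OF fp])
      also have "\<dots> = (\<Sum>t\<in>?T. integral UNIV (\<lambda>x. (\<Prod>k\<in>UNIV. a (t k)) * mixed_density P t x))"
        using int finT by (intro integral_sum integrable_on_mult_right) auto
      finally show ?thesis by simp
    next
      \<comment> \<open>For zero weights the gradient map is constant and the change of variables
        does not apply; both sides are 0, as every monomial has a factor.\<close>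
      case False
      then have z: "a j = 0" if "j \<in> J" for j using a that by force
      have "minkowski_comb a \<subseteq> {0}"
        unfolding minkowski_comb_def set_sum_alt[OF J] using z by (auto intro!: sum.neutral)
      then have "negligible (minkowski_comb a)" by (rule negligible_subset[rotated]) simp
      moreover have "(\<Prod>k\<in>UNIV. a (t k)) = 0" if "t \<in> ?T" for t using that z by auto
      ultimately show ?thesis by (simp add: negligible_imp_measure0 del: prod_zero_iff)
    qed
    then show "measure lebesgue (\<Sum>j\<in>J. (\<lambda>x. a j *\<^sub>R x) ` (convex hull P j)) =
       (\<Sum>t\<in>?T. (\<Prod>k\<in>UNIV. a (t k)) * integral UNIV (mixed_density P t))"
      by (simp add: minkowski_comb_def)
  qed
qed

section \<open>Mixed volumes as polarized coefficients\<close>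

text \<open>Convexity gives the inclusion from right to left:
  \<open>a *\<^sub>R x + b *\<^sub>R y\<close> is \<open>a + b\<close> times a weighted mean of
  \<open>x\<close> and \<open>y\<close>.\<close>

lemma scaleR_image_add:
  fixes S :: "'a::real_vector set"
  assumes "convex S" "0 \<le> a" "0 \<le> b"
  shows "(\<lambda>x. (a + b) *\<^sub>R x) ` S = (\<lambda>x. a *\<^sub>R x) ` S + (\<lambda>x. b *\<^sub>R x) ` S"
proof
  show "(\<lambda>x. (a + b) *\<^sub>R x) ` S \<subseteq> (\<lambda>x. a *\<^sub>R x) ` S + (\<lambda>x. b *\<^sub>R x) ` S"
    by (auto simp: scaleR_add_left)
  show "(\<lambda>x. a *\<^sub>R x) ` S + (\<lambda>x. b *\<^sub>R x) ` S \<subseteq> (\<lambda>x. (a + b) *\<^sub>R x) ` S"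
  proof
    fix z assume "z \<in> (\<lambda>x. a *\<^sub>R x) ` S + (\<lambda>x. b *\<^sub>R x) ` S"
    then obtain x y where xy: "x \<in> S" "y \<in> S" "z = a *\<^sub>R x + b *\<^sub>R y" by (auto elim!: set_plus_elim)
    show "z \<in> (\<lambda>x. (a + b) *\<^sub>R x) ` S"
    proof (cases "a + b = 0")
      case True
      then have "a = 0" "b = 0" using assms by auto
      then show ?thesis using xy by auto
    next
      case False
      then have "(a / (a + b)) *\<^sub>R x + (b / (a + b)) *\<^sub>R y \<in> S"
        using assms xy by (intro convexD) (auto simp: add_divide_distrib[symmetric])
      moreover have "z = (a + b) *\<^sub>R ((a / (a + b)) *\<^sub>R x + (b / (a + b)) *\<^sub>R y)"
        using False xy by (simp add: scaleR_add_right)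
      ultimately show ?thesis by blast
    qed
  qed
qed

lemma sum_const_convex:
  fixes S :: "'a::real_vector set"
  assumes "convex S" "S \<noteq> {}" "finite I"
  shows "(\<Sum>i\<in>I. S) = (\<lambda>x. real (card I) *\<^sub>R x) ` S"
  using assms(3)
proof (induction I rule: finite_induct)
  case empty
  then show ?case using assms(2) by (auto simp: set_zero)
next
  case (insert i I)
  have "(\<lambda>x. real (card (insert i I)) *\<^sub>R x) ` S = (\<lambda>x. (1 + real (card I)) *\<^sub>R x) ` S"
    using insert by simp
  also have "\<dots> = S + (\<Sum>i\<in>I. S)"
    using scaleR_image_add[OF assms(1), of 1 "real (card I)"] insert by simp
  finally show ?case using insert by simp
qed

text \<open>All that the rest of the argument uses about the bodies. \<open>I t\<close> will turn
  out to be the mixed volume of the bodies \<open>B (t k)\<close>, with \<open>k\<close> running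
  over the n slots.\<close>

locale volume_polynomial =
  fixes J :: "'j set" and B :: "'j \<Rightarrow> (real^'n::finite) set" and I :: "('n \<Rightarrow> 'j) \<Rightarrow> real"
  assumes J: "finite J"
    and B: "\<And>j. j \<in> J \<Longrightarrow> compact (B j)" "\<And>j. j \<in> J \<Longrightarrow> convex (B j)" "\<And>j. j \<in> J \<Longrightarrow> B j \<noteq> {}"
    and I_nonneg: "\<And>t. (\<And>k. t k \<in> J) \<Longrightarrow> 0 \<le> I t"
    and I_permute: "\<And>t p. p permutes UNIV \<Longrightarrow> I (t \<circ> p) = I t"
    and volume: "\<And>a. (\<And>j. j \<in> J \<Longrightarrow> 0 \<le> a j) \<Longrightarrow> measure lebesgue (\<Sum>j\<in>J. (\<lambda>x. a j *\<^sub>R x) ` B j) =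
       (\<Sum>t\<in>{t. \<forall>k. t k \<in> J}. (\<Prod>k\<in>UNIV. a (t k)) * I t)"
begin

text \<open>A body that occurs several times in the sum counts as one integer multiple of itself by
  convexity. Writing the multiplicities as sums of indicators and expanding the monomials leaves one
  term for each choice of an index per slot.\<close>

lemma measure_sum_indexed:
  assumes S: "finite S" and \<iota>: "\<And>i. i \<in> S \<Longrightarrow> \<iota> i \<in> J"
  shows "measure lebesgue (\<Sum>i\<in>S. B (\<iota> i)) = (\<Sum>s\<in>{s :: 'n \<Rightarrow> 'i. \<forall>k. s k \<in> S}. I (\<iota> \<circ> s))"
proof -
  let ?T = "{t :: 'n \<Rightarrow> 'j. \<forall>k. t k \<in> J}" and ?S = "{s :: 'n \<Rightarrow> 'i. \<forall>k. s k \<in> S}"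
  let ?a = "\<lambda>j. real (card {i\<in>S. \<iota> i = j})"
  have finT: "finite ?T" using J by (intro finite_functions_into)
  have "(\<Sum>i\<in>S. B (\<iota> i)) = (\<Sum>j\<in>J. \<Sum>i\<in>{i\<in>S. \<iota> i = j}. B (\<iota> i))"
    using S J \<iota> by (intro sum.group[symmetric]) auto
  also have "\<dots> = (\<Sum>j\<in>J. (\<lambda>x. ?a j *\<^sub>R x) ` B j)"
  proof (intro sum.cong refl)
    fix j assume j: "j \<in> J"
    have "(\<Sum>i\<in>{i\<in>S. \<iota> i = j}. B (\<iota> i)) = (\<Sum>i\<in>{i\<in>S. \<iota> i = j}. B j)" by (intro sum.cong) auto
    also have "\<dots> = (\<lambda>x. ?a j *\<^sub>R x) ` B j" using S B[OF j] by (intro sum_const_convex) auto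
    finally show "(\<Sum>i\<in>{i\<in>S. \<iota> i = j}. B (\<iota> i)) = (\<lambda>x. ?a j *\<^sub>R x) ` B j" .
  qed
  finally have "measure lebesgue (\<Sum>i\<in>S. B (\<iota> i)) = (\<Sum>t\<in>?T. (\<Prod>k\<in>UNIV. ?a (t k)) * I t)"
    by (simp add: volume)
  also have "\<dots> = (\<Sum>t\<in>?T. (\<Sum>s\<in>?S. if \<iota> \<circ> s = t then I t else 0))"
  proof (intro sum.cong refl)
    fix t
    have "?a j = (\<Sum>i\<in>S. of_bool (\<iota> i = j))" for j using S by (simp add: sum_of_bool_eq Int_def)
    then have "(\<Prod>k\<in>(UNIV :: 'n set). ?a (t k)) = (\<Prod>k\<in>UNIV. \<Sum>i\<in>S. of_bool (\<iota> i = t k))" by (simp only:)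
    also have "\<dots> = (\<Sum>s\<in>?S. \<Prod>k\<in>UNIV. of_bool (\<iota> (s k) = t k))"
      unfolding functions_into_eq_PiE using S by (intro prod_sum_PiE) auto
    also have "\<dots> = (\<Sum>s\<in>?S. of_bool (\<iota> \<circ> s = t))"
      by (intro sum.cong refl) (auto simp: fun_eq_iff)
    finally show "(\<Prod>k\<in>UNIV. ?a (t k)) * I t = (\<Sum>s\<in>?S. if \<iota> \<circ> s = t then I t else 0)"
      by (simp add: sum_distrib_right of_bool_def if_distrib[of "\<lambda>x. x * _"] cong: if_cong)
  qed
  also have "\<dots> = (\<Sum>s\<in>?S. \<Sum>t\<in>?T. if \<iota> \<circ> s = t then I t else 0)" by (rule sum.swap)
  also have "\<dots> = (\<Sum>s\<in>?S. I (\<iota> \<circ> s))"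
    using finT \<iota> by (intro sum.cong refl) (auto simp: sum.delta)
  finally show ?thesis .
qed

text \<open>The polarization formula is Moebius inversion over subsets of positions: it keeps only
  those choices of a position per slot that use every position, hence bijections. There are n! of
  them, all with the same value by symmetry of \<open>I\<close>. The bijection \<open>e\<close>
  matches slots with list positions.\<close>

lemma mixed_volume_eq:
  assumes Ks: "\<And>i. i < CARD('n) \<Longrightarrow> Ks ! i = B (\<iota> i)" "\<And>i. i < CARD('n) \<Longrightarrow> \<iota> i \<in> J"
    and e: "bij_betw e (UNIV :: 'n set) {..<CARD('n)}"
  shows "mixed_volume Ks = I (\<iota> \<circ> e)"
proof -
  define N where "N = {..<CARD('n)}"
  define g where "g S = (\<Sum>s\<in>{s :: 'n \<Rightarrow> nat. \<forall>k. s k \<in> S}. I (\<iota> \<circ> s))" for S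
  define f where "f U = (\<Sum>s\<in>{s :: 'n \<Rightarrow> nat. range s = U}. I (\<iota> \<circ> s))" for U
  have gf: "g S = sum f (Pow S)" if "finite S" for S
  proof -
    have "g S = (\<Sum>U\<in>Pow S. \<Sum>s\<in>{s \<in> {s. \<forall>k. s k \<in> S}. range s = U}. I (\<iota> \<circ> s))"
      unfolding g_def using that by (intro sum.group[symmetric] finite_functions_into) auto
    also have "\<dots> = sum f (Pow S)"
      unfolding f_def by (intro sum.cong) auto
    finally show ?thesis .
  qed
  have m: "measure lebesgue (\<Sum>i\<in>S. Ks ! i) = g S" if "S \<subseteq> N" for S
  proof -
    have "(\<Sum>i\<in>S. Ks ! i) = (\<Sum>i\<in>S. B (\<iota> i))" using that Ks by (intro sum.cong) (auto simp: N_def)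
    moreover have "finite S" using that by (simp add: N_def finite_subset)
    ultimately show ?thesis unfolding g_def using Ks that by (simp add: measure_sum_indexed N_def subset_iff)
  qed
  have "f N = (\<Sum>S\<in>Pow N. (-1) ^ (card N - card S) * g S)"
    by (rule inclusion_exclusion_mobius[OF gf]) (auto simp: N_def)
  \<comment> \<open>The empty set may be left out: no function maps the nonempty type of slots into
    it, so its term is 0.\<close>
  also have "\<dots> = (\<Sum>S\<in>{S. S \<subseteq> N \<and> S \<noteq> {}}. (-1) ^ (CARD('n) - card S) * measure lebesgue (\<Sum>i\<in>S. Ks ! i))"
    by (rule sum.mono_neutral_cong_right) (auto simp: m N_def g_def)
  finally have "fact CARD('n) * mixed_volume Ks = f N"
    unfolding mixed_volume_def N_def by simp
  also have "f N = (\<Sum>p | p permutes (UNIV :: 'n set). I (\<iota> \<circ> e \<circ> p))"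
    unfolding f_def
  proof (rule sum.reindex_bij_witness[where i = "\<lambda>p. e \<circ> p" and j = "\<lambda>s. inv e \<circ> s"])
    have inj: "inj e" and re: "range e = N" using e by (auto simp: bij_betw_def N_def)
    fix s :: "'n \<Rightarrow> nat" assume "s \<in> {s. range s = N}"
    then have s: "range s = N" by simp
    have es: "e (inv e (s k)) = s k" for k
      by (rule f_inv_into_f) (use s re in blast)
    then show "e \<circ> (inv e \<circ> s) = s" by (simp add: fun_eq_iff)
    have "card (range s) = CARD('n)" using s by (simp add: N_def)
    then have "inj s" by (simp add: eq_card_imp_inj_on)
    then have "inj (inv e \<circ> s)" by (metis (no_types, lifting) es injD injI o_apply)
    then have "bij (inv e \<circ> s)" using finite_UNIV_inj_surj[OF finite] by (intro bijI)
    then show "inv e \<circ> s \<in> {p. p permutes UNIV}" by (simp add: permutes_univ bij_iff)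
    show "I (\<iota> \<circ> e \<circ> (inv e \<circ> s)) = I (\<iota> \<circ> s)" using es by (simp add: o_def)
  next
    have inj: "inj e" and re: "range e = N" using e by (auto simp: bij_betw_def N_def)
    fix p assume "p \<in> {p. p permutes (UNIV :: 'n set)}"
    then have "surj p" by (simp add: permutes_surj)
    moreover have "range (e \<circ> p) = e ` range p" by (simp add: image_comp)
    ultimately show "e \<circ> p \<in> {s. range s = N}" using re by simp
    show "inv e \<circ> (e \<circ> p) = p" using inj by (simp add: fun_eq_iff)
  qed
  also have "\<dots> = (\<Sum>p | p permutes (UNIV :: 'n set). I (\<iota> \<circ> e))"
    by (intro sum.cong refl I_permute) auto
  also have "\<dots> = fact CARD('n) * I (\<iota> \<circ> e)" by (simp add: card_permutations[OF refl])
  finally show ?thesis by simp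
qed

definition comb :: "('j \<Rightarrow> real) \<Rightarrow> (real^'n) set" where
  "comb a = (\<Sum>j\<in>J. (\<lambda>x. a j *\<^sub>R x) ` B j)"

definition vol :: "('j \<Rightarrow> real) \<Rightarrow> real" where
  "vol a = (\<Sum>t\<in>{t. \<forall>k. t k \<in> J}. (\<Prod>k\<in>UNIV. a (t k)) * I t)"

lemma measure_comb: "(\<And>j. j \<in> J \<Longrightarrow> 0 \<le> a j) \<Longrightarrow> measure lebesgue (comb a) = vol a"
  unfolding comb_def vol_def by (rule volume)

lemma vol_scale: "vol (\<lambda>j. c * a j) = c ^ CARD('n) * vol a"
  unfolding vol_def by (simp add: prod.distrib sum_distrib_left mult.assoc)

lemma comb_add:
  assumes "\<And>j. j \<in> J \<Longrightarrow> 0 \<le> a j" "\<And>j. j \<in> J \<Longrightarrow> 0 \<le> b j"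
  shows "comb (\<lambda>j. a j + b j) = comb a + comb b"
  unfolding comb_def sum.distrib[symmetric] using assms B by (intro sum.cong scaleR_image_add) auto

lemma compact_convex_comb: "compact (comb a)" "convex (comb a)"
proof -
  show "convex (comb a)"
    unfolding comb_def using B by (intro convex_set_sum) (auto intro: convex_scaling)
  show "compact (comb a)"
    unfolding comb_def using B(1) by (intro compact_sum_sets compact_scaling)
qed

text \<open>Positive volume is the form in which the interior points for Brunn-Minkowski are
  supplied, since a convex compact set without interior has volume 0.\<close>

lemma root_vol_superadditive:
  assumes a: "\<And>j. j \<in> J \<Longrightarrow> 0 \<le> a j" "0 < vol a" and b: "\<And>j. j \<in> J \<Longrightarrow> 0 \<le> b j" "0 < vol b"
  shows "root CARD('n) (vol a) + root CARD('n) (vol b) \<le> root CARD('n) (vol (\<lambda>j. a j + b j))"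
proof -
  have int: "interior (comb c) \<noteq> {}" if "\<And>j. j \<in> J \<Longrightarrow> 0 \<le> c j" "0 < vol c" for c
  proof
    assume "interior (comb c) = {}"
    then have "measure lebesgue (comb c) = 0"
      using measure_interior_convex[of "comb c"] compact_convex_comb[of c] by (simp add: compact_imp_bounded)
    then show False using that measure_comb[of c] by simp
  qed
  have "root CARD('n) (measure lebesgue (comb a)) + root CARD('n) (measure lebesgue (comb b)) \<le> root CARD('n) (measure lebesgue (comb a + comb b))"
    using brunn_minkowski_convex[of "comb a" "comb b"] compact_convex_comb int[of a] int[of b] a b by simp
  then show ?thesis
    using a b by (simp add: comb_add[symmetric] measure_comb)
qed

end

section \<open>The quadratic inequality\<close>

lemma sum_atMost_add_2:
  fixes C :: "nat \<Rightarrow> real"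
  shows "(\<Sum>d\<le>m + 2. C d * t ^ d) = C 0 + C 1 * t + t\<^sup>2 * (\<Sum>d\<le>m. C (d + 2) * t ^ d)"
proof -
  have "(\<Sum>d\<le>m + 2. C d * t ^ d) = (\<Sum>d\<le>Suc (Suc m). C d * t ^ d)" by simp
  also have "\<dots> = C 0 + C 1 * t + t\<^sup>2 * (\<Sum>d\<le>m. C (d + 2) * t ^ d)"
    unfolding sum.atMost_Suc_shift
    by (simp add: sum_distrib_left power2_eq_square mult_ac)
  finally show ?thesis .
qed

lemma tendsto_polynomial_at_right_0:
  fixes C :: "nat \<Rightarrow> real"
  shows "((\<lambda>t. \<Sum>d\<le>m. C d * t ^ d) \<longlongrightarrow> C 0) (at_right 0)"
proof -
  have "((\<lambda>t. \<Sum>d\<le>m. C d * t ^ d) \<longlongrightarrow> (\<Sum>d\<le>m. C d * 0 ^ d)) (at_right 0)"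
    by (intro tendsto_intros)
  moreover have "(\<Sum>d\<le>m. C d * 0 ^ d) = C 0"
    by (subst sum.remove[of _ 0]) auto
  ultimately show ?thesis by simp
qed

text \<open>The terms of degree 0 and 1 cancel; division by the square of \<open>t\<close> and the
  limit from the right compare what comes next.\<close>

lemma quadratic_coefficient_le:
  fixes C D :: "nat \<Rightarrow> real"
  assumes "C 0 = D 0" "C 1 = D 1"
    and le: "\<And>t. 0 < t \<Longrightarrow> (\<Sum>d\<le>m + 2. C d * t ^ d) \<le> (\<Sum>d\<le>m + 2. D d * t ^ d)"
  shows "C 2 \<le> D 2"
proof (rule tendsto_le)
  show "((\<lambda>t. \<Sum>d\<le>m. C (d + 2) * t ^ d) \<longlongrightarrow> C 2) (at_right 0)"
    "((\<lambda>t. \<Sum>d\<le>m. D (d + 2) * t ^ d) \<longlongrightarrow> D 2) (at_right 0)"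
    using tendsto_polynomial_at_right_0[where C = "\<lambda>d. C (d + 2)"] tendsto_polynomial_at_right_0[where C = "\<lambda>d. D (d + 2)"]
    by (simp_all add: numeral_2_eq_2)
  have "(\<Sum>d\<le>m. C (d + 2) * t ^ d) \<le> (\<Sum>d\<le>m. D (d + 2) * t ^ d)" if "0 < t" for t
    using le[OF that] that assms(1,2) unfolding sum_atMost_add_2 by simp
  then show "\<forall>\<^sub>F t in at_right 0. (\<Sum>d\<le>m. C (d + 2) * t ^ d) \<le> (\<Sum>d\<le>m. D (d + 2) * t ^ d)"
    by (auto simp: eventually_at_right_less intro: eventually_mono[OF eventually_at_right_less])
qed simp

text \<open>Concavity bounds \<open>p t\<close> by \<open>C 0 * (1 + \<alpha> * t) ^ n\<close>, where \<open>\<alpha>\<close> makes the linear coefficients agree;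
  the claim compares the quadratic ones.\<close>
lemma root_concave_polynomial_coefficients:
  fixes C :: "nat \<Rightarrow> real" and n m :: nat
  defines "n \<equiv> m + 2" and "p \<equiv> \<lambda>t. \<Sum>d\<le>m + 2. C d * t ^ d"
  assumes C0: "0 < C 0" and pos: "\<And>t. 0 < t \<Longrightarrow> 0 \<le> p t"
    and conc: "\<And>s t. 0 < s \<Longrightarrow> s < t \<Longrightarrow> (1 - s / t) * root n (C 0) + s / t * root n (p t) \<le> root n (p s)"
  shows "2 * n * C 0 * C 2 \<le> (n - 1) * (C 1)\<^sup>2"
proof -
  have n: "0 < n" by (simp add: n_def)
  define \<alpha> where "\<alpha> = C 1 / (n * C 0)"
  have tangent: "p t \<le> C 0 * (1 + \<alpha> * t) ^ n" if t: "0 < t" for t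
  proof -
    define r where "r = root n (p t) / root n (C 0)"
    have r: "0 \<le> r" using pos[OF t] C0 n by (simp add: r_def)
    have rn: "C 0 * r ^ n = p t" using pos[OF t] C0 n by (simp add: r_def power_divide)
    have lower: "n * C 0 * (r - 1) / t \<le> C 1 + s * (\<Sum>d\<le>m. C (d + 2) * s ^ d)" if s: "0 < s" "s < t" for s
    proof -
      \<comment> \<open>The condition of Bernoulli's inequality; it holds since \<open>r\<close> is
        nonnegative and \<open>s\<close> is less than \<open>t\<close>.\<close>
      have "-1 \<le> s / t * (r - 1)"
      proof -
        have "s / t * (r - 1) \<ge> s / t * (-1)" using s r by (intro mult_left_mono) auto
        moreover have "s / t \<le> 1" using s by simp
        ultimately show ?thesis by simp
      qed
      then have "C 0 * (1 + n * (s / t * (r - 1))) \<le> C 0 * (1 + s / t * (r - 1)) ^ n"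
        using C0 Bernoulli_inequality[of "s / t * (r - 1)" n] by (intro mult_left_mono) auto
      also have "\<dots> = (root n (C 0) * (1 + s / t * (r - 1))) ^ n"
        using C0 n by (simp add: power_mult_distrib)
      also have "root n (C 0) * (1 + s / t * (r - 1)) = (1 - s / t) * root n (C 0) + s / t * root n (p t)"
      proof -
        have "root n (p t) = root n (C 0) * r" using C0 n by (simp add: r_def)
        then show ?thesis by (simp add: algebra_simps add_divide_distrib diff_divide_distrib)
      qed
      also have "\<dots> ^ n \<le> root n (p s) ^ n"
      proof (rule power_mono)
        show "0 \<le> (1 - s / t) * root n (C 0) + s / t * root n (p t)"
          using s C0 pos[OF t] n by (intro add_nonneg_nonneg mult_nonneg_nonneg) auto
      qed (use conc s in auto)
      also have "\<dots> = p s" using pos[OF s(1)] n by simp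
      also have "\<dots> = C 0 + s * (C 1 + s * (\<Sum>d\<le>m. C (d + 2) * s ^ d))"
        unfolding p_def sum_atMost_add_2 by (simp add: power2_eq_square algebra_simps)
      finally have "s * (n * C 0 * (r - 1) / t) \<le> s * (C 1 + s * (\<Sum>d\<le>m. C (d + 2) * s ^ d))"
        by (simp add: field_simps)
      then show ?thesis using s(1) by (rule mult_left_le_imp_le)
    qed
    \<comment> \<open>As \<open>s\<close> tends to 0, the slope of the chord of the n-th root from 0
      to \<open>t\<close> is bounded by its slope at 0.\<close>
    have "n * C 0 * (r - 1) / t \<le> C 1"
    proof (rule tendsto_lowerbound)
      have "((\<lambda>s. C 1 + s * (\<Sum>d\<le>m. C (d + 2) * s ^ d)) \<longlongrightarrow> C 1 + 0 * C (0 + 2)) (at_right 0)"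
        by (intro tendsto_intros tendsto_polynomial_at_right_0[where C = "\<lambda>d. C (d + 2)"])
      then show "((\<lambda>s. C 1 + s * (\<Sum>d\<le>m. C (d + 2) * s ^ d)) \<longlongrightarrow> C 1) (at_right 0)" by simp
      show "\<forall>\<^sub>F s in at_right 0. n * C 0 * (r - 1) / t \<le> C 1 + s * (\<Sum>d\<le>m. C (d + 2) * s ^ d)"
        unfolding eventually_at_right[OF t] using lower t by blast
    qed simp
    then have "r \<le> 1 + \<alpha> * t" using C0 n t by (simp add: \<alpha>_def field_simps)
    then have "C 0 * r ^ n \<le> C 0 * (1 + \<alpha> * t) ^ n" using C0 r by (intro mult_left_mono power_mono) auto
    then show ?thesis by (simp add: rn)
  qed
  define D where "D d = C 0 * (real (n choose d) * \<alpha> ^ d)" for d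
  have D: "C 0 * (1 + \<alpha> * t) ^ n = (\<Sum>d\<le>m + 2. D d * t ^ d)" for t
  proof -
    have "C 0 * (1 + \<alpha> * t) ^ n = C 0 * (\<Sum>d\<le>n. real (n choose d) * (\<alpha> * t) ^ d)"
      using binomial_ring[of "\<alpha> * t" 1 n] by (simp add: add.commute)
    also have "\<dots> = (\<Sum>d\<le>n. D d * t ^ d)"
      unfolding D_def sum_distrib_left by (intro sum.cong refl) (simp add: power_mult_distrib mult_ac)
    finally show ?thesis by (simp only: n_def)
  qed
  have "C 2 \<le> D 2"
  proof (rule quadratic_coefficient_le)
    show "C 0 = D 0" by (simp add: D_def)
    show "C 1 = D 1" using C0 n by (simp add: D_def \<alpha>_def)
    show "(\<Sum>d\<le>m + 2. C d * t ^ d) \<le> (\<Sum>d\<le>m + 2. D d * t ^ d)" if "0 < t" for t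
      using tangent[OF that] unfolding D p_def .
  qed
  also have "D 2 = C 0 * (real n * (real n - 1) / 2 * \<alpha>\<^sup>2)"
  proof -
    have "real (n choose 2) = real (n * (n - 1)) / 2"
      unfolding choose_two using real_of_nat_div[of 2 "n * (n - 1)"] by (cases "even n") (simp_all del: of_nat_mult)
    also have "\<dots> = real n * (real n - 1) / 2" using n by (simp add: of_nat_diff)
    finally show ?thesis by (simp add: D_def)
  qed
  finally have "2 * n * C 0 * C 2 \<le> 2 * n * C 0 * (C 0 * (real n * (real n - 1) / 2 * \<alpha>\<^sup>2))"
    using C0 by (intro mult_left_mono) auto
  also have "\<dots> = (n - 1) * (C 1)\<^sup>2"
    using C0 n by (simp add: \<alpha>_def field_simps power2_eq_square of_nat_diff)
  finally show ?thesis .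
qed

text \<open>The natural choice x = q, y = p is void when p q = 0; with q + e and p + e the product
  stays positive and the bound follows as \<open>e\<close> tends to 0.\<close>

lemma bilinear_bound:
  fixes c p q :: real
  assumes "0 \<le> p" "0 \<le> q" and le: "\<And>x y. 0 \<le> x \<Longrightarrow> 0 \<le> y \<Longrightarrow> 2 * c * (x * y) \<le> (x * p + y * q)\<^sup>2"
  shows "c \<le> 2 * p * q"
proof (rule tendsto_lowerbound)
  show "((\<lambda>e. 2 * (p + e) * (q + e)) \<longlongrightarrow> 2 * p * q) (at_right 0)"
    by (rule tendsto_eq_intros refl | simp)+
  have "c \<le> 2 * (p + e) * (q + e)" if e: "0 < e" for e
  proof -
    let ?z = "(q + e) * (p + e)"
    have z: "0 < ?z" using assms e by (intro mult_pos_pos) auto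
    have "2 * c * ?z \<le> ((q + e) * p + (p + e) * q)\<^sup>2" using assms e by (intro le) auto
    also have "\<dots> \<le> (2 * ?z)\<^sup>2" using assms e by (intro power_mono) (auto simp: algebra_simps)
    also have "\<dots> = 2 * (2 * ?z) * ?z" by (simp add: power2_eq_square)
    finally have "c \<le> 2 * ?z" using z mult_right_le_imp_le[of "2 * c" ?z "2 * (2 * ?z)"] by linarith
    then show ?thesis by (simp only: mult_ac)
  qed
  then show "\<forall>\<^sub>F e in at_right 0. c \<le> 2 * (p + e) * (q + e)"
    by (auto intro: eventually_mono[OF eventually_at_right_less])
qed simp

lemma prod_if_one_scale:
  fixes c :: real and b :: "'a \<Rightarrow> real"
  assumes "finite A"
  shows "(\<Prod>k\<in>A. if Q k then 1 else c * b k) = c ^ card {k\<in>A. \<not> Q k} * (\<Prod>k\<in>A. if Q k then 1 else b k)"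
proof -
  have "(\<Prod>k\<in>A. if Q k then 1 else c * b k) = (\<Prod>k\<in>A. if Q k then 1 else c) * (\<Prod>k\<in>A. if Q k then 1 else b k)"
    unfolding prod.distrib[symmetric] by (intro prod.cong) auto
  also have "(\<Prod>k\<in>A. if Q k then 1 else c) = c ^ card (A \<inter> - {k. Q k})"
    using assms by (simp add: prod.If_cases)
  also have "A \<inter> - {k. Q k} = {k\<in>A. \<not> Q k}" by auto
  finally show ?thesis .
qed

text \<open>\<open>B 2\<close> plays the role of A and \<open>B 0\<close>, \<open>B 1\<close> those
  of K1, K2. Every mixed volume that occurs is a value of \<open>I\<close>, so the claim becomes one
  about the coefficients of the volume of \<open>B 2\<close> plus a multiple of a combination of
  \<open>B 0\<close> and \<open>B 1\<close>.\<close>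

lemma mixed_volume_bezout_polynomial:
  fixes B :: "nat \<Rightarrow> (real^'n::finite) set"
  assumes vp: "volume_polynomial {0, 1, 2} B I" and n2: "CARD('n) \<ge> 2" and pos: "0 < measure lebesgue (B 2)"
  shows "measure lebesgue (B 2) * mixed_volume ([B 0, B 1] @ replicate (CARD('n) - 2) (B 2))
         \<le> 2 * mixed_volume (B 0 # replicate (CARD('n) - 1) (B 2)) * mixed_volume (B 1 # replicate (CARD('n) - 1) (B 2))"
proof -
  interpret volume_polynomial "{0, 1, 2}" B I by fact
  let ?n = "CARD('n)"
  obtain m where m: "?n = m + 2" using n2 by (metis add.commute le_Suc_ex)
  let ?T = "{t :: 'n \<Rightarrow> nat. \<forall>k. t k \<in> {0, 1, 2}}"
  have finT: "finite ?T" by (intro finite_functions_into) auto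
  obtain e where e: "bij_betw e (UNIV :: 'n set) {..<?n}"
    using ex_bij_betw_finite_nat[of "UNIV :: 'n set"] by (auto simp: atLeast0LessThan)
  have inj: "inj e" and range: "range e = {..<?n}" using e by (auto simp: bij_betw_def)
  obtain k0 k1 where k0: "e k0 = 0" and k1: "e k1 = 1"
    using range n2 by (metis imageE lessThan_iff less_le_trans zero_less_numeral one_less_numeral_iff semiring_norm(76))
  have ne: "k0 \<noteq> k1" using k0 k1 by auto
  have ek: "e k = 0 \<longleftrightarrow> k = k0" "e k = 1 \<longleftrightarrow> k = k1" for k
    using inj k0 k1 by (metis injD)+
  \<comment> \<open>The assignment of A to all slots; the other mixed volumes come from updating it
    in one or two slots.\<close>
  define E where "E = (\<lambda>_ :: 'n. 2 :: nat)"
  have mv1: "mixed_volume (B j # replicate (?n - 1) (B 2)) = I (E(k0 := j))" if "j \<in> {0, 1}" for j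
  proof -
    have "mixed_volume (B j # replicate (?n - 1) (B 2)) = I ((\<lambda>i. if i = 0 then j else 2) \<circ> e)"
      by (rule mixed_volume_eq[OF _ _ e]) (use that in \<open>auto simp: nth_Cons split: nat.split\<close>)
    also have "(\<lambda>i. if i = 0 then j else 2) \<circ> e = E(k0 := j)"
      by (auto simp: fun_eq_iff E_def ek)
    finally show ?thesis .
  qed
  have mv2: "mixed_volume ([B 0, B 1] @ replicate (?n - 2) (B 2)) = I (E(k0 := 0, k1 := 1))"
  proof -
    have "mixed_volume ([B 0, B 1] @ replicate (?n - 2) (B 2)) = I ((\<lambda>i. if i = 0 then 0 else if i = 1 then 1 else 2) \<circ> e)"
      by (rule mixed_volume_eq[OF _ _ e]) (auto simp: nth_Cons split: nat.split)
    also have "(\<lambda>i. if i = 0 then 0 else if i = 1 then 1 else 2) \<circ> e = E(k0 := 0, k1 := 1)"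
      using ne by (simp only: fun_eq_iff o_apply ek) (simp add: E_def)
    finally show ?thesis .
  qed
  define V where "V j = I (E(k0 := j))" for j
  define W where "W = I (E(k0 := 0, k1 := 1))"
  have V: "I (E(k := j)) = V j" for k j
  proof -
    have "E(k := j) = E(k0 := j) \<circ> Transposition.transpose k k0"
      by (auto simp: fun_eq_iff E_def Transposition.transpose_def)
    then show ?thesis unfolding V_def by (simp add: I_permute permutes_swap_id)
  qed
  have W: "I (E(k := 0, l := 1)) = W" if "k \<noteq> l" for k l
  proof -
    \<comment> \<open>The swap of \<open>k\<close> and \<open>k0\<close> may move \<open>l\<close>,
      so the second swap sends the image of \<open>l\<close>, not \<open>l\<close> itself, to
      \<open>k1\<close>.\<close>
    define p where "p = Transposition.transpose (Transposition.transpose k k0 l) k1 \<circ> Transposition.transpose k k0"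
    have p: "p permutes UNIV" unfolding p_def by (intro permutes_compose permutes_swap_id) auto
    have "p k = k0" "p l = k1" using that ne by (auto simp: p_def Transposition.transpose_def)
    then have "p i = k0 \<longleftrightarrow> i = k" "p i = k1 \<longleftrightarrow> i = l" for i using permutes_inj[OF p] by (metis injD)+
    then have "E(k := 0, l := 1) = E(k0 := 0, k1 := 1) \<circ> p"
      by (auto simp: fun_eq_iff E_def)
    then show ?thesis unfolding W_def by (simp only: I_permute[OF p])
  qed
  have Vnn: "0 \<le> V j" if "j \<in> {0, 1}" for j
    unfolding V_def using that by (intro I_nonneg) (auto simp: E_def)
  have IE: "I E = measure lebesgue (B 2)"
  proof -
    have "{s :: 'n \<Rightarrow> nat. \<forall>k. s k \<in> {0}} = {\<lambda>_. 0}" by (auto simp: fun_eq_iff)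
    then show ?thesis using measure_sum_indexed[of "{0 :: nat}" "\<lambda>_. 2"] by (simp add: E_def o_def)
  qed
  have quad: "2 * (I E * W) * (x * y) \<le> (x * V 0 + y * V 1)\<^sup>2" if x: "0 \<le> x" and y: "0 \<le> y" for x y
  proof -
    \<comment> \<open>\<open>comb (bt c)\<close> is \<open>B 2\<close> plus c times (x
      \<open>B 0\<close> + y \<open>B 1\<close>), and \<open>C i\<close> is the coefficient of
      \<open>c ^ i\<close> in its volume. The degree \<open>d t\<close> of an assignment counts the
      slots not given to \<open>B 2\<close>.\<close>
    define b where "b j = (if j = 0 then x else y)" for j :: nat
    have b: "0 \<le> b j" for j using x y by (simp add: b_def)
    define bt where "bt t j = (if j = 2 then 1 else t * b j)" for t :: real and j :: nat
    define w where "w t = (\<Prod>k\<in>UNIV. if t k = 2 then 1 else b (t k))" for t :: "'n \<Rightarrow> nat"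
    define d where "d t = card {k. t k \<noteq> 2}" for t :: "'n \<Rightarrow> nat"
    define C where "C i = (\<Sum>t\<in>{t\<in>?T. d t = i}. w t * I t)" for i
    have wI: "0 \<le> w t * I t" if "t \<in> ?T" for t
      unfolding w_def using b that by (intro mult_nonneg_nonneg prod_nonneg I_nonneg) auto
    have Cnn: "0 \<le> C i" for i unfolding C_def using wI by (intro sum_nonneg) auto
    have dn: "d t \<le> m + 2" for t unfolding d_def m[symmetric] by (intro card_mono) auto
    have vol: "vol (bt c) = (\<Sum>i\<le>m + 2. C i * c ^ i)" for c
    proof -
      have "vol (bt c) = (\<Sum>t\<in>?T. c ^ d t * (w t * I t))"
        unfolding vol_def bt_def d_def w_def by (subst prod_if_one_scale) (auto simp: mult.assoc)
      also have "\<dots> = (\<Sum>i\<le>m + 2. \<Sum>t\<in>{t\<in>?T. d t = i}. c ^ d t * (w t * I t))"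
        using finT dn by (intro sum.group[symmetric]) auto
      also have "\<dots> = (\<Sum>i\<le>m + 2. C i * c ^ i)"
        unfolding C_def by (intro sum.cong refl) (simp add: sum_distrib_left mult.commute)
      finally show ?thesis .
    qed
    have C0: "C 0 = I E"
    proof -
      have "{t\<in>?T. d t = 0} = {E}" by (auto simp: d_def E_def)
      then show ?thesis by (simp add: C_def w_def E_def)
    qed
    have C1: "C 1 = ?n * (x * V 0 + y * V 1)"
    proof -
      have set: "{t\<in>?T. d t = 1} = (\<lambda>(k, j). E(k := j)) ` (UNIV \<times> {0, 1})"
      proof (intro set_eqI iffI)
        fix t assume t: "t \<in> {t\<in>?T. d t = 1}"
        then obtain k where k: "{k. t k \<noteq> 2} = {k}" by (auto simp: d_def card_1_singleton_iff)
        then have "t = E(k := t k)" by (auto simp: fun_eq_iff E_def)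
        moreover have "t k \<in> {0, 1}" using k t by auto
        ultimately obtain j where "t = E(k := j)" "j \<in> {0, 1}" by metis
        then show "t \<in> (\<lambda>(k, j). E(k := j)) ` (UNIV \<times> {0, 1})" by auto
      next
        fix t assume "t \<in> (\<lambda>(k, j). E(k := j)) ` (UNIV \<times> {0, 1})"
        then obtain k j where kj: "t = E(k := j)" "j \<in> {0, 1}" by auto
        then have "{i. t i \<noteq> 2} = {k}" by (auto simp: E_def)
        then show "t \<in> {t\<in>?T. d t = 1}" using kj by (auto simp: d_def E_def)
      qed
      have inj: "inj_on (\<lambda>(k, j). E(k := j)) (UNIV \<times> {0, 1})"
      proof (rule inj_onI, clarify)
        fix k j k' j' assume j: "j \<in> {0, 1}" "j' \<in> {0, 1}" and eq: "E(k := j) = E(k' := j')"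
        from fun_cong[OF eq, of k] j have "k = k'" by (auto simp: E_def split: if_splits)
        with fun_cong[OF eq, of k] show "k = k' \<and> j = j'" by simp
      qed
      have "w (E(k := j)) = b j" if "j \<in> {0, 1}" for k j
      proof -
        have "w (E(k := j)) = (\<Prod>i\<in>UNIV. if i = k then b j else 1)"
          unfolding w_def using that by (intro prod.cong) (auto simp: E_def)
        then show ?thesis by simp
      qed
      then have "C 1 = (\<Sum>(k, j)\<in>(UNIV :: 'n set) \<times> {0, 1}. b j * V j)"
        unfolding C_def set sum.reindex[OF inj] by (intro sum.cong) (auto simp: V)
      also have "\<dots> = ?n * (x * V 0 + y * V 1)"
        unfolding sum.cartesian_product[symmetric] by (simp add: b_def)
      finally show ?thesis .
    qed
    \<comment> \<open>Assignments of degree 2 with one slot for \<open>B 0\<close> and one for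
      \<open>B 1\<close> correspond to the n (n - 1) ordered pairs of distinct slots. Those using
      the same body twice contribute nonnegatively and are dropped.\<close>
    have C2: "?n * (real ?n - 1) * (x * y * W) \<le> C 2"
    proof -
      let ?K = "Sigma (UNIV :: 'n set) (\<lambda>k. UNIV - {k})"
      let ?g = "\<lambda>(k, l). E(k := 0, l := 1)"
      have inj: "inj_on ?g ?K"
      proof (rule inj_onI)
        fix u v assume uv: "u \<in> ?K" "v \<in> ?K" "?g u = ?g v"
        obtain k l k' l' where u: "u = (k, l)" and v: "v = (k', l')" by (cases u, cases v)
        have kl: "k \<noteq> l" "k' \<noteq> l'" and eq: "E(k := 0, l := 1) = E(k' := 0, l' := 1)"
          using uv by (auto simp: u v)
        from fun_cong[OF eq, of k] kl have "k = k'" by (auto simp: E_def split: if_splits)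
        moreover from fun_cong[OF eq, of l] kl have "l = l'" by (auto simp: E_def split: if_splits)
        ultimately show "u = v" by (simp add: u v)
      qed
      have wE: "w (E(k := 0, l := 1)) = x * y" if "k \<noteq> l" for k l
      proof -
        have "w (E(k := 0, l := 1)) = (\<Prod>i\<in>UNIV. (if i = k then x else 1) * (if i = l then y else 1))"
          unfolding w_def using that by (intro prod.cong) (auto simp: E_def b_def)
        then show ?thesis by (simp add: prod.distrib)
      qed
      have "card ?K = ?n * (?n - 1)" by (simp add: card_Diff_singleton)
      then have "?n * (real ?n - 1) * (x * y * W) = (\<Sum>kl\<in>?K. x * y * W)"
        using n2 by (simp add: of_nat_diff)
      also have "\<dots> = (\<Sum>t\<in>?g ` ?K. w t * I t)"
      proof -
        have "x * y * W = w (E(k := 0, l := 1)) * I (E(k := 0, l := 1))" if "l \<noteq> k" for k l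
          using W[of k l] wE[of k l] that by metis
        then show ?thesis unfolding sum.reindex[OF inj] by (intro sum.cong) auto
      qed
      also have "\<dots> \<le> C 2"
        unfolding C_def
      proof (rule sum_mono2)
        show "?g ` ?K \<subseteq> {t\<in>?T. d t = 2}"
        proof
          fix t assume "t \<in> ?g ` ?K"
          then obtain u where u: "u \<in> ?K" "t = ?g u" by (rule imageE)
          obtain k l where "u = (k, l)" by (cases u)
          then have kl: "k \<noteq> l" "t = E(k := 0, l := 1)" using u by auto
          then have "{i. t i \<noteq> 2} = {k, l}" by (auto simp: E_def)
          then show "t \<in> {t\<in>?T. d t = 2}" using kl by (auto simp: d_def E_def)
        qed
      qed (use finT wI in auto)
      finally show ?thesis .
    qed
    have C0pos: "0 < C 0" using pos by (simp add: C0 IE)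
    have ppos: "0 < (\<Sum>i\<le>m + 2. C i * c ^ i)" if "0 \<le> c" for c
    proof (rule sum_pos2)
      show "0 < C 0 * c ^ 0" using C0pos by simp
    qed (use that Cnn in auto)
    have "2 * ?n * C 0 * C 2 \<le> (?n - 1) * (C 1)\<^sup>2"
      unfolding m
    proof (rule root_concave_polynomial_coefficients[of C m])
      show "0 < C 0" by (rule C0pos)
      show "0 \<le> (\<Sum>i\<le>m + 2. C i * c ^ i)" if "0 < c" for c using ppos[of c] that by simp
      fix s t :: real assume st: "0 < s" "s < t"
      define l where "l = s / t"
      have l: "0 < l" "l < 1" "l * t = s" using st by (auto simp: l_def)
      note [simp del] = One_nat_def
      have v0: "vol (bt 0) = C 0"
        unfolding vol by (subst sum.remove[of _ 0]) auto
      have vt: "0 < vol (bt t)" using ppos[of t] st unfolding vol by linarith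
      have sc: "root ?n (vol (\<lambda>j. c * a j)) = c * root ?n (vol a)" if "0 < c" for c a
        using that by (simp add: vol_scale real_root_mult real_root_power_cancel)
      \<comment> \<open>\<open>bt s\<close> is the convex combination of \<open>bt 0\<close> and
        \<open>bt t\<close> with weight s / t, so superadditivity and homogeneity give concavity of
        the root between 0 and \<open>t\<close>.\<close>
      have "root ?n (vol (\<lambda>j. (1 - l) * bt 0 j)) + root ?n (vol (\<lambda>j. l * bt t j))
          \<le> root ?n (vol (\<lambda>j. (1 - l) * bt 0 j + l * bt t j))"
      proof (rule root_vol_superadditive)
        show "0 < vol (\<lambda>j. (1 - l) * bt 0 j)" "0 < vol (\<lambda>j. l * bt t j)"
          using l C0pos vt by (simp_all add: vol_scale v0)
      qed (use l st b in \<open>auto simp: bt_def\<close>)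
      moreover have "(\<lambda>j. (1 - l) * bt 0 j + l * bt t j) = bt s"
        using l(3) by (auto simp: bt_def fun_eq_iff)
      ultimately have "(1 - l) * root ?n (C 0) + l * root ?n (vol (bt t)) \<le> root ?n (vol (bt s))"
        using sc[of "1 - l"] sc[of l] l by (simp add: v0)
      then show "(1 - s / t) * root (m + 2) (C 0) + s / t * root (m + 2) (\<Sum>i\<le>m + 2. C i * t ^ i)
          \<le> root (m + 2) (\<Sum>i\<le>m + 2. C i * s ^ i)"
        unfolding vol m l_def .
    qed
    moreover have "2 * ?n * C 0 * (?n * (real ?n - 1) * (x * y * W)) \<le> 2 * ?n * C 0 * C 2"
      using C2 C0pos by (intro mult_left_mono) auto
    ultimately have "2 * ?n * C 0 * (?n * (real ?n - 1) * (x * y * W)) \<le> (?n - 1) * (C 1)\<^sup>2"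
      by (rule order_trans[rotated])
    then have "2 * ?n * I E * (?n * (real ?n - 1) * (x * y * W)) \<le> (real ?n - 1) * (?n * (x * V 0 + y * V 1))\<^sup>2"
      using n2 unfolding C0 C1 by (simp add: of_nat_diff)
    then have "(real ?n ^ 2 * (real ?n - 1)) * (2 * (I E * W) * (x * y)) \<le> (real ?n ^ 2 * (real ?n - 1)) * (x * V 0 + y * V 1)\<^sup>2"
      by (simp add: power2_eq_square mult_ac)
    moreover have "0 < real ?n ^ 2 * (real ?n - 1)" using n2 by simp
    ultimately show ?thesis by (rule mult_left_le_imp_le)
  qed
  have "I E * W \<le> 2 * V 0 * V 1"
    using Vnn by (intro bilinear_bound quad) auto
  then show ?thesis using mv1[of 0] mv1[of 1] unfolding mv2 IE V_def W_def by simp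
qed

section \<open>Approximation by polytopes\<close>

text \<open>\<open>Y m\<close> is squeezed between \<open>X\<close> and its closed neighbourhood of
  radius \<open>r / Suc m\<close>. These neighbourhoods decrease to \<open>X\<close>, since
  \<open>X\<close> is closed, and the measure is continuous from above.\<close>

lemma measure_tendsto_outer:
  fixes X :: "'a::euclidean_space set" and Y :: "nat \<Rightarrow> 'a set"
  assumes X: "compact X" and Y: "\<And>m. compact (Y m)" "\<And>m. X \<subseteq> Y m" "\<And>m. Y m \<subseteq> X + cball 0 (r / Suc m)"
    and "0 \<le> r"
  shows "(\<lambda>m. measure lebesgue (Y m)) \<longlonglongrightarrow> measure lebesgue X"
proof -
  define Z where "Z m = X + cball 0 (r / Suc m)" for m
  have cZ: "compact (Z m)" for m unfolding Z_def by (intro compact_set_plus X compact_cball)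
  have lim: "(\<lambda>m. r / Suc m) \<longlonglongrightarrow> 0" by (rule LIMSEQ_Suc[OF lim_const_over_n])
  have "(\<Inter>m. Z m) = X"
  proof
    show "X \<subseteq> (\<Inter>m. Z m)" using order_trans[OF Y(2,3)] unfolding Z_def by (intro INF_greatest)
    show "(\<Inter>m. Z m) \<subseteq> X"
    proof
      fix x assume x: "x \<in> (\<Inter>m. Z m)"
      have "\<exists>y\<in>X. dist y x < e" if "0 < e" for e
      proof -
        obtain m where m: "r / Suc m < e"
          using order_tendstoD(2)[OF lim \<open>0 < e\<close>] by (auto simp: eventually_sequentially)
        have "x \<in> X + cball 0 (r / Suc m)" using x by (auto simp: Z_def)
        then obtain y z where "y \<in> X" "norm z \<le> r / Suc m" "x = y + z" by (auto elim!: set_plus_elim)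
        then show ?thesis using m by (intro bexI[of _ y]) (auto simp: dist_norm)
      qed
      then show "x \<in> X" using X by (metis closure_approachable closure_closed compact_imp_closed)
    qed
  qed
  moreover have "(\<lambda>m. measure lebesgue (Z m)) \<longlonglongrightarrow> measure lebesgue (\<Inter>m. Z m)"
  proof (rule Lim_measure_decseq)
    show "range Z \<subseteq> sets lebesgue" using cZ lmeasurable_compact fmeasurableD by blast
    show "decseq Z"
      unfolding Z_def decseq_def
      by (intro allI impI set_plus_mono2 subset_refl subset_cball divide_left_mono) (auto simp: \<open>0 \<le> r\<close>)
    show "emeasure lebesgue (Z m) \<noteq> \<infinity>" for m
      unfolding infinity_ennreal_def using lmeasurable_compact[OF cZ] by (rule fmeasurableD2)
  qed
  ultimately have lim: "(\<lambda>m. measure lebesgue (Z m)) \<longlonglongrightarrow> measure lebesgue X" by simp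
  have le1: "\<forall>\<^sub>F m in sequentially. measure lebesgue (Y m) \<le> measure lebesgue (Z m)"
    using Y cZ unfolding Z_def
    by (intro always_eventually allI measure_mono_fmeasurable fmeasurableD lmeasurable_compact) auto
  have le2: "\<forall>\<^sub>F m in sequentially. measure lebesgue X \<le> measure lebesgue (Y m)"
    using X Y by (intro always_eventually allI measure_mono_fmeasurable fmeasurableD lmeasurable_compact) auto
  show ?thesis by (rule tendsto_sandwich[OF le2 le1 tendsto_const lim])
qed

lemma sum_sets_mono:
  fixes X Y :: "'i \<Rightarrow> 'a::comm_monoid_add set"
  assumes "\<And>i. i \<in> S \<Longrightarrow> X i \<subseteq> Y i"
  shows "(\<Sum>i\<in>S. X i) \<subseteq> (\<Sum>i\<in>S. Y i)"
  using assms by (induction S rule: infinite_finite_induct) (auto intro!: set_plus_mono2 del: subsetI)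

lemma sum_sets_plus_cball:
  fixes X Y :: "'i \<Rightarrow> 'a::real_normed_vector set" and e :: real
  assumes "finite S" "\<And>i. i \<in> S \<Longrightarrow> Y i \<subseteq> X i + cball 0 e" "0 \<le> e"
  shows "(\<Sum>i\<in>S. Y i) \<subseteq> (\<Sum>i\<in>S. X i) + cball 0 (card S * e)"
  using assms(1,2)
proof (induction S rule: finite_induct)
  case empty
  then show ?case by (auto simp: set_zero)
next
  case (insert i S)
  have cb: "cball (0::'a) e + cball 0 (card S * e) \<subseteq> cball 0 (card (insert i S) * e)"
  proof
    fix z assume "z \<in> cball (0::'a) e + cball 0 (card S * e)"
    then obtain x y where "z = x + y" "norm x \<le> e" "norm y \<le> card S * e" by (auto elim!: set_plus_elim)
    then show "z \<in> cball 0 (card (insert i S) * e)"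
      using insert norm_triangle_ineq[of x y] by (simp add: algebra_simps)
  qed
  have "(\<Sum>i\<in>insert i S. Y i) \<subseteq> (X i + cball 0 e) + ((\<Sum>i\<in>S. X i) + cball 0 (card S * e))"
    using insert by (simp add: set_plus_mono2)
  also have "(X i + cball 0 e) + ((\<Sum>i\<in>S. X i) + cball 0 (card S * e))
      = (\<Sum>i\<in>insert i S. X i) + (cball 0 e + cball 0 (card S * e))"
    using insert by (simp add: add_ac)
  also have "\<dots> \<subseteq> (\<Sum>i\<in>insert i S. X i) + cball 0 (card (insert i S) * e)"
    by (intro set_plus_mono2 subset_refl cb)
  finally show ?case .
qed

text \<open>The hull of a finite net in \<open>K\<close> plus a small cube: the cube fills the gaps
  of the net and provides interior points even when \<open>K\<close> has none.\<close>

lemma polytope_outer_approx: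
  fixes K :: "'a::euclidean_space set"
  assumes K: "compact K" "convex K" "K \<noteq> {}" and "0 < e"
  shows "\<exists>P. finite P \<and> interior (convex hull P) \<noteq> {} \<and> K \<subseteq> convex hull P \<and> convex hull P \<subseteq> K + cball 0 e"
proof -
  \<comment> \<open>The norm is at most the sum of the DIM('a) absolute coordinates, so the cube of
    half-side \<open>d\<close> lies in the ball of radius \<open>e\<close>.\<close>
  define d where "d = e / DIM('a)"
  have d: "0 < d" using \<open>0 < e\<close> by (simp add: d_def)
  define C where "C = cbox (- (\<Sum>i\<in>Basis. d *\<^sub>R i)) (\<Sum>i\<in>Basis. d *\<^sub>R i :: 'a)"
  have memC: "z \<in> C \<longleftrightarrow> (\<forall>i\<in>Basis. \<bar>z \<bullet> i\<bar> \<le> d)" for z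
    by (auto simp: C_def mem_box abs_le_iff minus_le_iff)
  obtain S :: "'a set" where S: "finite S" "C = convex hull S"
    using cube_convex_hull[OF d, of 0] by (auto simp: C_def)
  obtain N where N: "N \<subseteq> K" "finite N" "K \<subseteq> (\<Union>x\<in>N. ball x d)"
    by (rule compactE_image[OF K(1), of K "\<lambda>x. ball x d"]) (use d in auto)
  obtain y where y: "y \<in> N" using N K by auto
  have hull: "convex hull (N + S) = convex hull N + C" by (simp add: convex_hull_set_plus S(2))
  show ?thesis
  proof (intro exI conjI)
    show "finite (N + S)" using N S by (simp add: finite_set_plus)
    show "K \<subseteq> convex hull (N + S)"
    proof
      fix x assume "x \<in> K"
      then obtain z where z: "z \<in> N" "dist z x < d" using N by auto
      have "\<bar>(x - z) \<bullet> i\<bar> \<le> d" if "i \<in> Basis" for i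
        using Basis_le_norm[OF that, of "x - z"] z(2) by (simp add: dist_norm norm_minus_commute)
      then have "z + (x - z) \<in> convex hull N + C" using z by (intro set_plus_intro) (auto simp: memC hull_inc)
      then show "x \<in> convex hull (N + S)" by (simp add: hull)
    qed
    have "convex hull N \<subseteq> K" using N K by (intro hull_minimal)
    moreover have "C \<subseteq> cball 0 e"
    proof
      fix z assume "z \<in> C"
      then have "(\<Sum>i\<in>Basis. \<bar>z \<bullet> i\<bar>) \<le> (\<Sum>i\<in>(Basis :: 'a set). d)" by (intro sum_mono) (simp add: memC)
      then show "z \<in> cball 0 e" using norm_le_l1[of z] by (simp add: d_def)
    qed
    ultimately show "convex hull (N + S) \<subseteq> K + cball 0 e" unfolding hull by (rule set_plus_mono2)
    have "(+) y ` C \<subseteq> convex hull (N + S)" unfolding hull using y by (auto simp: hull_inc)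
    then have "(+) y ` interior C \<subseteq> interior (convex hull (N + S))"
      unfolding interior_translation[symmetric] by (rule interior_mono)
    moreover have "interior C \<noteq> {}"
      using d by (simp add: C_def box_ne_empty)
    ultimately show "interior (convex hull (N + S)) \<noteq> {}" by blast
  qed
qed

text \<open>Errors add under Minkowski sums, so each of the finitely many sums is approximated from
  outside within \<open>card S / Suc m\<close>.\<close>

lemma mixed_volume_tendsto:
  fixes Ks :: "(real^'n::finite) set list" and L :: "nat \<Rightarrow> (real^'n) set list"
  assumes "\<And>i. i < CARD('n) \<Longrightarrow> compact (Ks ! i)" "\<And>m i. i < CARD('n) \<Longrightarrow> compact (L m ! i)"
    "\<And>m i. i < CARD('n) \<Longrightarrow> Ks ! i \<subseteq> L m ! i" "\<And>m i. i < CARD('n) \<Longrightarrow> L m ! i \<subseteq> Ks ! i + cball 0 (1 / Suc m)"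
  shows "(\<lambda>m. mixed_volume (L m)) \<longlonglongrightarrow> mixed_volume Ks"
  unfolding mixed_volume_def
proof (intro tendsto_mult tendsto_const tendsto_sum)
  fix S assume "S \<in> {S. S \<subseteq> {..<CARD('n)} \<and> S \<noteq> {}}"
  then have S: "finite S" "\<And>i. i \<in> S \<Longrightarrow> i < CARD('n)" by (auto intro: finite_subset)
  show "(\<lambda>m. measure lebesgue (\<Sum>i\<in>S. L m ! i)) \<longlonglongrightarrow> measure lebesgue (\<Sum>i\<in>S. Ks ! i)"
  proof (rule measure_tendsto_outer[where r = "card S"])
    show "(\<Sum>i\<in>S. L m ! i) \<subseteq> (\<Sum>i\<in>S. Ks ! i) + cball 0 (real (card S) / real (Suc m))" for m
      using sum_sets_plus_cball[OF S(1), of "\<lambda>i. L m ! i" "\<lambda>i. Ks ! i" "1 / Suc m"] assms(4) S(2) by simp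
    show "compact (\<Sum>i\<in>S. Ks ! i)" "compact (\<Sum>i\<in>S. L m ! i)" for m
      by (intro compact_sum_sets assms S; assumption)+
    show "(\<Sum>i\<in>S. Ks ! i) \<subseteq> (\<Sum>i\<in>S. L m ! i)" for m
      by (intro sum_sets_mono assms S; assumption)
  qed simp
qed

section \<open>Arbitrary finite index types\<close>

text \<open>The library's change of variables theorem requires a well-ordered index type; \<open>'a ordered_copy\<close>
  supplies one for every finite type.\<close>

typedef 'a ordered_copy = "UNIV :: 'a set" morphisms of_copy to_copy ..

lemma bij_of_copy: "bij of_copy"
  by (metis UNIV_I bijI' of_copy_inject to_copy_inverse)

instance ordered_copy :: (finite) finite
proof
  show "finite (UNIV :: 'a ordered_copy set)"
    using bij_betw_finite[of of_copy UNIV "UNIV :: 'a set"] bij_of_copy by auto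
qed

instantiation ordered_copy :: (finite) wellorder
begin

definition less_eq_ordered_copy :: "'a ordered_copy \<Rightarrow> 'a ordered_copy \<Rightarrow> bool" where
  "x \<le> y \<longleftrightarrow> to_nat (of_copy x) \<le> to_nat (of_copy y)"

definition less_ordered_copy :: "'a ordered_copy \<Rightarrow> 'a ordered_copy \<Rightarrow> bool" where
  "x < y \<longleftrightarrow> to_nat (of_copy x) < to_nat (of_copy y)"

instance
proof
  fix Q :: "'a ordered_copy \<Rightarrow> bool" and a
  assume step: "\<And>x. (\<And>y. y < x \<Longrightarrow> Q y) \<Longrightarrow> Q x"
  show "Q a"
  proof (induction a rule: measure_induct_rule[where f = "\<lambda>x. to_nat (of_copy x)"])
    case (less x)
    then show ?case by (rule step) (simp only: less_ordered_copy_def)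
  qed
next
  fix x y z :: "'a ordered_copy"
  show "x < y \<longleftrightarrow> x \<le> y \<and> \<not> y \<le> x" "x \<le> x" "x \<le> y \<Longrightarrow> y \<le> z \<Longrightarrow> x \<le> z" "x \<le> y \<or> y \<le> x"
    unfolding less_eq_ordered_copy_def less_ordered_copy_def by linarith+
  show "x = y" if "x \<le> y" "y \<le> x"
    using that unfolding less_eq_ordered_copy_def by (metis antisym of_copy_inject to_nat_split)
qed

end

section \<open>Lebesgue measure and mixed volumes under relabelling of coordinates\<close>

definition reindex :: "real^'n::finite \<Rightarrow> real^('n ordered_copy)" where
  "reindex x = (\<chi> k. x $ of_copy k)"

definition unindex :: "real^('n::finite ordered_copy) \<Rightarrow> real^'n" where
  "unindex y = (\<chi> k. y $ to_copy k)"

lemma reindex_inverse [simp]: "unindex (reindex x) = x" "reindex (unindex y) = y"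
  by (simp_all add: reindex_def unindex_def vec_eq_iff to_copy_inverse of_copy_inverse)

lemma linear_reindex: "linear reindex"
  by (rule linearI) (simp_all add: reindex_def vec_eq_iff)

lemma continuous_on_reindex: "continuous_on S reindex"
  using linear_reindex by (rule linear_continuous_on[OF linear_conv_bounded_linear[THEN iffD1]])

lemma card_ordered_copy: "CARD('n::finite ordered_copy) = CARD('n)"
  using bij_betw_same_card[OF bij_of_copy] .

lemma prod_Basis_vec: "(\<Prod>b\<in>Basis. x \<bullet> b) = (\<Prod>k\<in>UNIV. (x :: real^'n::finite) $ k)"
proof -
  have Basis: "(Basis :: (real^'n) set) = (\<lambda>k. axis k 1) ` UNIV" by (auto simp: Basis_vec_def)
  have inj: "inj (\<lambda>k :: 'n. axis k (1::real))" by (auto simp: inj_def axis_eq_axis)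
  show ?thesis unfolding Basis prod.reindex[OF inj] by (simp add: inner_axis)
qed

text \<open>Relabelling carries boxes to boxes with the same side lengths, and Lebesgue measure is
  determined by its values on boxes.\<close>

lemma lborel_reindex: "lborel = distr lborel borel (reindex :: real^'n::finite \<Rightarrow> _)"
proof (rule lborel_eqI)
  have meas: "(reindex :: real^'n \<Rightarrow> _) \<in> borel_measurable borel"
    by (intro borel_measurable_continuous_onI continuous_on_reindex)
  fix l u :: "real^('n ordered_copy)" assume le: "\<And>b. b \<in> Basis \<Longrightarrow> l \<bullet> b \<le> u \<bullet> b"
  have le': "l $ k \<le> u $ k" for k using le[of "axis k 1"] by (simp add: inner_axis axis_in_Basis_iff)
  have vim: "reindex -` box l u = box (unindex l) (unindex u)"
  proof (intro set_eqI iffI)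
    fix x assume "x \<in> reindex -` box l u"
    then have *: "l $ k < x $ of_copy k \<and> x $ of_copy k < u $ k" for k by (simp add: mem_box_cart reindex_def)
    show "x \<in> box (unindex l) (unindex u)"
      using *[of "to_copy _"] by (simp add: mem_box_cart unindex_def to_copy_inverse)
  next
    fix x assume "x \<in> box (unindex l) (unindex u)"
    then have *: "l $ to_copy k < x $ k \<and> x $ k < u $ to_copy k" for k by (simp add: mem_box_cart unindex_def)
    show "x \<in> reindex -` box l u"
      using *[of "of_copy _"] by (simp add: mem_box_cart reindex_def of_copy_inverse)
  qed
  have le'': "unindex l \<bullet> b \<le> unindex u \<bullet> b" if "b \<in> Basis" for b
    using that le' by (auto simp: Basis_vec_def inner_axis unindex_def)
  have "emeasure (distr lborel borel reindex) (box l u) = emeasure lborel (box (unindex l) (unindex u))"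
    using meas by (simp add: emeasure_distr vim)
  also have "\<dots> = ennreal (\<Prod>b\<in>Basis. (unindex u - unindex l) \<bullet> b)"
    using le'' by (simp add: emeasure_lborel_box)
  also have "(\<Prod>b\<in>Basis. (unindex u - unindex l) \<bullet> b) = (\<Prod>k\<in>UNIV. (u - l) $ to_copy k)"
    by (simp add: prod_Basis_vec unindex_def)
  also have "\<dots> = (\<Prod>k\<in>UNIV. (u - l) $ k)"
    by (rule prod.reindex_bij_witness[where i = of_copy and j = to_copy]) (auto simp: to_copy_inverse of_copy_inverse)
  finally show "emeasure (distr lborel borel reindex) (box l u) = (\<Prod>b\<in>Basis. (u - l) \<bullet> b)"
    by (simp add: prod_Basis_vec)
qed simp

lemma measure_reindex:
  fixes S :: "(real^'n::finite) set"
  assumes "compact S"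
  shows "measure lebesgue (reindex ` S) = measure lebesgue S"
proof -
  have S: "S \<in> sets borel" using assms by (simp add: borel_closed compact_imp_closed)
  have R: "reindex ` S \<in> sets borel"
    using compact_continuous_image[OF continuous_on_reindex assms] by (simp add: borel_closed compact_imp_closed)
  have meas: "(reindex :: real^'n \<Rightarrow> _) \<in> borel_measurable borel"
    by (intro borel_measurable_continuous_onI continuous_on_reindex)
  have "inj (reindex :: real^'n \<Rightarrow> _)" by (metis injI reindex_inverse(1))
  then have "reindex -` (reindex ` S) = S" by (rule inj_vimage_image_eq)
  then have "measure (distr lborel borel reindex) (reindex ` S) = measure lborel S"
    using R meas by (simp add: measure_distr)
  then show ?thesis using S R by (simp add: lborel_reindex[symmetric])
qed

text \<open>A linear map commutes with Minkowski sums, so each volume in the polarization formula is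
  preserved.\<close>

lemma mixed_volume_reindex:
  fixes Ks :: "(real^'n::finite) set list"
  assumes "length Ks = CARD('n)" "\<And>K. K \<in> set Ks \<Longrightarrow> compact K"
  shows "mixed_volume (map ((`) reindex) Ks) = mixed_volume Ks"
proof -
  have eq: "measure lebesgue (\<Sum>i\<in>S. map ((`) reindex) Ks ! i) = measure lebesgue (\<Sum>i\<in>S. Ks ! i)"
    if "S \<subseteq> {..<CARD('n)}" for S
  proof -
    have "(\<Sum>i\<in>S. map ((`) reindex) Ks ! i) = (\<Sum>i\<in>S. ((`) reindex \<circ> (!) Ks) i)"
      using that assms(1) by (intro sum.cong) auto
    also have "\<dots> = reindex ` (\<Sum>i\<in>S. Ks ! i)"
    proof (rule sum_set_linear[symmetric])
      show "reindex ` A + reindex ` B = reindex ` (A + B)" for A B :: "(real^'n) set"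
        by (force simp: set_plus_image image_image linear_add[OF linear_reindex] case_prod_beta)
      show "reindex ` {0} = {0}" using linear_0[OF linear_reindex] by simp
    qed
    also have "measure lebesgue \<dots> = measure lebesgue (\<Sum>i\<in>S. Ks ! i)"
      using that assms by (intro measure_reindex compact_sum_sets) auto
    finally show ?thesis .
  qed
  show ?thesis
    unfolding mixed_volume_def card_ordered_copy
    by (rule arg_cong[where f = "\<lambda>s. 1 / fact CARD('n) * s"], rule sum.cong[OF refl]) (simp only: eq mem_Collect_eq)
qed

text \<open>The inequality is closed under outer approximation of the three bodies by polytopes,
  which also admits bodies without interior points.\<close>

lemma mixed_volume_bezout_wellorder:
  fixes A K1 K2 :: "(real^'n::{finite,wellorder}) set"
  assumes n2: "CARD('n) \<ge> 2" and cb: "convex_body A" "convex_body K1" "convex_body K2"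
  shows "measure lebesgue A * mixed_volume ([K1, K2] @ replicate (CARD('n) - 2) A)
         \<le> 2 * mixed_volume (K1 # replicate (CARD('n) - 1) A) * mixed_volume (K2 # replicate (CARD('n) - 1) A)"
proof -
  let ?n = "CARD('n)"
  define K where "K j = (if j = 0 then K1 else if j = 1 then K2 else A)" for j :: nat
  have K: "compact (K j)" "convex (K j)" "K j \<noteq> {}" for j
    using cb by (auto simp: K_def convex_body_def)
  have "\<forall>m j. \<exists>P. finite P \<and> interior (convex hull P) \<noteq> {} \<and> K j \<subseteq> convex hull P \<and> convex hull P \<subseteq> K j + cball 0 (1 / real (Suc m))"
    using polytope_outer_approx[OF K] by simp
  then obtain P where P: "finite (P m j)" "interior (convex hull P m j) \<noteq> {}" "K j \<subseteq> convex hull P m j"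
     "convex hull P m j \<subseteq> K j + cball 0 (1 / real (Suc m))" for m j
    by metis
  define B where "B m j = convex hull P m j" for m j
  have cB: "compact (B m j)" "convex (B m j)" for m j
    unfolding B_def using P(1) by (auto intro: finite_imp_compact_convex_hull)
  have ineq: "measure lebesgue (B m 2) * mixed_volume ([B m 0, B m 1] @ replicate (?n - 2) (B m 2))
         \<le> 2 * mixed_volume (B m 0 # replicate (?n - 1) (B m 2)) * mixed_volume (B m 1 # replicate (?n - 1) (B m 2))" for m
  proof (rule volume_minkowski_comb_polynomial)
    show "full_polytopes {0, 1, 2 :: nat} (P m)" using P by unfold_locales auto
    fix I :: "('n \<Rightarrow> nat) \<Rightarrow> real"
    assume I: "\<And>t. (\<And>k. t k \<in> {0, 1, 2}) \<Longrightarrow> 0 \<le> I t" "\<And>t p. p permutes UNIV \<Longrightarrow> I (t \<circ> p) = I t"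
      "\<And>a. (\<And>j. j \<in> {0, 1, 2} \<Longrightarrow> 0 \<le> a j) \<Longrightarrow> measure lebesgue (\<Sum>j\<in>{0, 1, 2}. (\<lambda>x. a j *\<^sub>R x) ` (convex hull P m j)) =
         (\<Sum>t\<in>{t. \<forall>k. t k \<in> {0, 1, 2}}. (\<Prod>k\<in>UNIV. a (t k)) * I t)"
    have "volume_polynomial {0, 1, 2} (B m) I"
    proof
      show "B m j \<noteq> {}" for j using P(2)[of m j] interior_subset by (auto simp: B_def)
    qed (use cB I in \<open>auto simp: B_def\<close>)
    moreover have "0 < measure lebesgue (B m 2)"
    proof -
      have "\<not> negligible (interior (B m 2))" using P(2)[of m 2] by (intro open_not_negligible) (auto simp: B_def)
      moreover have bdd: "bounded (B m 2)" using cB(1) by (rule compact_imp_bounded)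
      ultimately have "measure lebesgue (interior (B m 2)) \<noteq> 0"
        using negligible_iff_measure lmeasurable_interior by blast
      then show ?thesis unfolding measure_interior_convex[OF bdd cB(2)] by (simp add: zero_less_measure_iff)
    qed
    ultimately show ?thesis using n2 by (intro mixed_volume_bezout_polynomial)
  qed
  have lim: "(\<lambda>m. mixed_volume (map (B m) js)) \<longlonglongrightarrow> mixed_volume (map K js)" if "length js = ?n" for js
    using that P cB K by (intro mixed_volume_tendsto) (simp_all add: B_def)
  have lim0: "(\<lambda>m. measure lebesgue (B m 2)) \<longlonglongrightarrow> measure lebesgue (K 2)"
    using K cB P(3,4) by (intro measure_tendsto_outer[where r = 1]) (simp_all add: B_def)
  have lim2: "(\<lambda>m. mixed_volume ([B m 0, B m 1] @ replicate (?n - 2) (B m 2))) \<longlonglongrightarrow> mixed_volume ([K 0, K 1] @ replicate (?n - 2) (K 2))"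
    using lim[of "[0, 1] @ replicate (?n - 2) 2"] n2 by (simp add: map_replicate_const)
  have lim1: "(\<lambda>m. mixed_volume (B m j # replicate (?n - 1) (B m 2))) \<longlonglongrightarrow> mixed_volume (K j # replicate (?n - 1) (K 2))" for j
    using lim[of "j # replicate (?n - 1) 2"] n2 by (simp add: map_replicate_const)
  have "measure lebesgue (K 2) * mixed_volume ([K 0, K 1] @ replicate (?n - 2) (K 2))
      \<le> 2 * mixed_volume (K 0 # replicate (?n - 1) (K 2)) * mixed_volume (K 1 # replicate (?n - 1) (K 2))"
    by (rule LIMSEQ_le[OF tendsto_mult[OF lim0 lim2] tendsto_mult[OF tendsto_mult[OF tendsto_const lim1] lim1]])
      (use ineq in blast)
  then show ?thesis by (simp add: K_def)
qed

theorem theorem1p5: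
  fixes A K1 K2 :: "(real^'n::finite) set"
  assumes "CARD('n) \<ge> 2"
    and "convex_body A" and "convex_body K1" and "convex_body K2"
  shows "measure lebesgue A * mixed_volume ([K1, K2] @ replicate (CARD('n) - 2) A)
         \<le> 2 * mixed_volume (K1 # replicate (CARD('n) - 1) A)
             * mixed_volume (K2 # replicate (CARD('n) - 1) A)"
proof -
  let ?R = "(`) (reindex :: real^'n \<Rightarrow> _)"
  have comp: "compact A" "compact K1" "compact K2" using assms by (auto simp: convex_body_def)
  have cb: "convex_body (?R K)" if "convex_body K" for K
    using that unfolding convex_body_def
    by (auto intro: compact_continuous_image[OF continuous_on_reindex] convex_linear_image[OF linear_reindex])
  have "measure lebesgue (?R A) * mixed_volume ([?R K1, ?R K2] @ replicate (CARD('n) - 2) (?R A))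
      \<le> 2 * mixed_volume (?R K1 # replicate (CARD('n) - 1) (?R A)) * mixed_volume (?R K2 # replicate (CARD('n) - 1) (?R A))"
    using mixed_volume_bezout_wellorder[of "?R A" "?R K1" "?R K2"] assms cb by (simp only: card_ordered_copy)
  moreover have "mixed_volume ([?R K1, ?R K2] @ replicate (CARD('n) - 2) (?R A)) = mixed_volume ([K1, K2] @ replicate (CARD('n) - 2) A)"
  proof -
    have "length ([K1, K2] @ replicate (CARD('n) - 2) A) = CARD('n)" using assms(1) by simp
    moreover have "compact K" if "K \<in> set ([K1, K2] @ replicate (CARD('n) - 2) A)" for K
      using that comp by (auto split: if_splits)
    ultimately show ?thesis using mixed_volume_reindex[of "[K1, K2] @ replicate (CARD('n) - 2) A"] by simp
  qed
  moreover have "mixed_volume (?R K # replicate (CARD('n) - 1) (?R A)) = mixed_volume (K # replicate (CARD('n) - 1) A)"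
    if "compact K" for K
  proof -
    have "length (K # replicate (CARD('n) - 1) A) = CARD('n)" by simp
    moreover have "compact L" if "L \<in> set (K # replicate (CARD('n) - 1) A)" for L
      using that \<open>compact K\<close> comp by (auto split: if_splits)
    ultimately show ?thesis using mixed_volume_reindex[of "K # replicate (CARD('n) - 1) A"] by simp
  qed
  ultimately show ?thesis using comp by (simp only: measure_reindex)
qed

end
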